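(* Let $k\ge3$ be fixed, let $\mathbb F$ be a finite field of characteristic $p$, let $\varepsilon\in(0,1)$, and let $\ell$ satisfy $\frac{n}{\max(|\mathbb F^*|,k)}\ge\ell\ge\max(k,\log(|\mathbb F^*|n))$. Let $\mathcal I=(\mathcal H,\{b_v\}_{v\in\mathcal H})$ be a random $k$-$\mathrm{LIN}(\mathbb F)$ instance with $|\mathcal H|=\Theta(n)\cdot\left(\frac{n|\mathbb F^*|}{\ell}\right)^{k/2-1}\cdot\varepsilon^{-2}$ (for a suitable constant depending on $k$). Then with high probability over the draw of $\mathcal I$: 1. $\mathrm{val}(\mathcal I)\le\frac1{|\mathbb F|}+\varepsilon$; 2. there is a complex pseudo-expectation $\widetilde{\mathbb E}$ of degree $\widetilde\Omega(\ell)$ (for fixed $\varepsilon$, i.e. $\ell$ up to a factor polylogarithmic in $|\mathbb F^*|n$) that satisfies all the constraints of a complex pseudo-expectation and has $\widetilde{\mathbb E}\left[\prod_{i\in\mathrm{supp}(v)}y_{i,\beta v_i}\right]=\omega_p^{\mathrm{Tr}(\beta b_v)}$ for all $v\in\mathcal H$ and $\beta\in\mathbb F^*$.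
   Context: $\mathbb F^*=\mathbb F\setminus\{0\}$, $\omega_p=e^{2\pi i/p}$, $\mathrm{Tr}$ the trace from $\mathbb F$ to $\mathbb F_p$, $\mathrm{supp}(v)=\{i:v_i\ne0\}$. A random $k$-$\mathrm{LIN}(\mathbb F)$ instance: $\mathcal H$ is a uniformly random set of $k$-sparse vectors (exactly $k$ nonzero coordinates) in $\mathbb F^n$ and each $b_v$ is independent uniform in $\mathbb F$; $\mathrm{val}(\mathcal I)=\max_{x\in\mathbb F^n}\frac1{|\mathcal H|}\sum_v\mathbf 1(\sum_iv_ix_i=b_v)$. Complex indeterminates $y_{i,\alpha}$ ($i\in[n],\alpha\in\mathbb F^*$) with convention $y_{i,0}=1$. The variable degree of a monomial is the number of $i\in[n]$ such that some $y_{i,\alpha}$ (or conjugate) appears with nonzero exponent; of a polynomial, the max over monomials. A degree-$d$ complex pseudo-expectation is a linear map $\widetilde{\mathbb E}$ from polynomials of variable degree $\le d$ to $\mathbb C$ with $\widetilde{\mathbb E}[1]=1$; $\widetilde{\mathbb E}[|f|^2]\ge0$ for $f$ of variable degree $\le d/2$; $\widetilde{\mathbb E}[f(y_{i,\alpha}^p-1)]=0$ for $f$ of variable degree $\le d-1$; and $\widetilde{\mathbb E}[f(y_{i,\alpha}\overline{y_{i,\beta}}-y_{i,\alpha-\beta})]=0$ for $f$ of variable degree $\le d-2$. *)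

theory Defs
  imports
    "HOL-Probability.Probability"
    "HOL-Library.Poly_Mapping"
    "HOL-Library.Nonpos_Ints"
    "HOL-Algebra.Ring"
begin

text \<open>
  Finite fields are \<open>HOL-Algebra\<close> records rather than types of class \<open>field\<close>, so that a statement
  can quantify over all of them after its constants have been chosen. Every finite field is
  isomorphic to one whose carrier lies in a given infinite type, e.g. \<open>nat\<close>.
\<close>

subsection \<open>Characteristic and trace of a finite field\<close>

definition field_char :: "'a ring \<Rightarrow> nat" where
  "field_char F = (LEAST p. 0 < p \<and> [p] \<cdot>\<^bsub>F\<^esub> \<one>\<^bsub>F\<^esub> = \<zero>\<^bsub>F\<^esub>)"

definition prime_degree :: "'a ring \<Rightarrow> nat" where
  "prime_degree F = (THE e. card (carrier F) = field_char F ^ e)"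

text \<open>The trace to the prime field, as the sum of the conjugates of \<open>x\<close> under Frobenius.\<close>

definition field_trace :: "'a ring \<Rightarrow> 'a \<Rightarrow> 'a" where
  "field_trace F x = (\<Oplus>\<^bsub>F\<^esub>j\<in>{..<prime_degree F}. x [^]\<^bsub>F\<^esub> (field_char F ^ j))"

text \<open>
  \<open>trace_rep F x\<close> is the representative in \<open>{0..<p}\<close> of the trace, an element of the prime
  field \<open>{[r] \<cdot> \<one> | r < p}\<close>; powers of \<open>\<omega>\<^sub>p\<close> depend only on it.
\<close>

definition trace_rep :: "'a ring \<Rightarrow> 'a \<Rightarrow> nat" where
  "trace_rep F x = (THE r. r < field_char F \<and> [r] \<cdot>\<^bsub>F\<^esub> \<one>\<^bsub>F\<^esub> = field_trace F x)"

definition omega :: "nat \<Rightarrow> complex" where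
  "omega p = exp (2 * complex_of_real pi * \<i> / of_nat p)"


subsection \<open>Random \<open>k\<close>-LIN instances\<close>

text \<open>The space of vectors of length \<open>n\<close> is the extensional function space \<open>{..<n} \<rightarrow>\<^sub>E carrier F\<close>.\<close>

definition supp :: "'a ring \<Rightarrow> nat \<Rightarrow> (nat \<Rightarrow> 'a) \<Rightarrow> nat set" where
  "supp F n v = {i\<in>{..<n}. v i \<noteq> \<zero>\<^bsub>F\<^esub>}"

definition sparse_vecs :: "'a ring \<Rightarrow> nat \<Rightarrow> nat \<Rightarrow> (nat \<Rightarrow> 'a) set" where
  "sparse_vecs F n k = {v \<in> {..<n} \<rightarrow>\<^sub>E carrier F. card (supp F n v) = k}"

type_synonym 'a klin = "(nat \<Rightarrow> 'a) set \<times> ((nat \<Rightarrow> 'a) \<Rightarrow> 'a)"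

text \<open>
  \<open>m\<close> is the number of equations. Outside \<open>H\<close> the right-hand side function has the dummy
  value \<open>\<zero>\<close>. If there are fewer than \<open>m\<close> sparse vectors, the distribution is unspecified.
\<close>

definition random_klin :: "'a ring \<Rightarrow> nat \<Rightarrow> nat \<Rightarrow> nat \<Rightarrow> 'a klin pmf" where
  "random_klin F n k m =
     do {
       H \<leftarrow> pmf_of_set {H. H \<subseteq> sparse_vecs F n k \<and> card H = m};
       b \<leftarrow> Pi_pmf H \<zero>\<^bsub>F\<^esub> (\<lambda>_. pmf_of_set (carrier F));
       return_pmf (H, b)
     }"

definition klin_val :: "'a ring \<Rightarrow> nat \<Rightarrow> 'a klin \<Rightarrow> real" where
  "klin_val F n I = (case I of (H, b) \<Rightarrow>
     Max ((\<lambda>x. real (card {v\<in>H. (\<Oplus>\<^bsub>F\<^esub>i\<in>{..<n}. v i \<otimes>\<^bsub>F\<^esub> x i) = b v}) / real (card H))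
          ` ({..<n} \<rightarrow>\<^sub>E carrier F)))"


subsection \<open>Polynomials in complex indeterminates and their conjugates\<close>

text \<open>\<open>Y i \<alpha>\<close> stands for \<open>y\<^sub>i\<^sub>,\<^sub>\<alpha>\<close> and \<open>Ybar i \<alpha>\<close> for its formal complex conjugate.\<close>

datatype 'a cvar = Y (site: nat) (label: 'a) | Ybar (site: nat) (label: 'a)

type_synonym 'a cmonom = "'a cvar \<Rightarrow>\<^sub>0 nat"
type_synonym 'a cpoly = "'a cmonom \<Rightarrow>\<^sub>0 complex"

definition const_poly :: "complex \<Rightarrow> 'a cpoly" where
  "const_poly c = Poly_Mapping.single 0 c"

definition var_poly :: "'a cvar \<Rightarrow> 'a cpoly" where
  "var_poly v = Poly_Mapping.single (Poly_Mapping.single v 1) 1"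

text \<open>The convention \<open>y\<^sub>i\<^sub>,\<^sub>0 = 1\<close> is built into \<open>y_poly\<close> and \<open>ybar_poly\<close>.\<close>

definition y_poly :: "'a ring \<Rightarrow> nat \<Rightarrow> 'a \<Rightarrow> 'a cpoly" where
  "y_poly F i \<alpha> = (if \<alpha> = \<zero>\<^bsub>F\<^esub> then 1 else var_poly (Y i \<alpha>))"

definition ybar_poly :: "'a ring \<Rightarrow> nat \<Rightarrow> 'a \<Rightarrow> 'a cpoly" where
  "ybar_poly F i \<alpha> = (if \<alpha> = \<zero>\<^bsub>F\<^esub> then 1 else var_poly (Ybar i \<alpha>))"

fun conj_var :: "'a cvar \<Rightarrow> 'a cvar" where
  "conj_var (Y i \<alpha>) = Ybar i \<alpha>"
| "conj_var (Ybar i \<alpha>) = Y i \<alpha>"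

definition conj_monom :: "'a cmonom \<Rightarrow> 'a cmonom" where
  "conj_monom m =
     (\<Sum>v\<in>Poly_Mapping.keys m. Poly_Mapping.single (conj_var v) (Poly_Mapping.lookup m v))"

definition conj_poly :: "'a cpoly \<Rightarrow> 'a cpoly" where
  "conj_poly f =
     (\<Sum>m\<in>Poly_Mapping.keys f. Poly_Mapping.single (conj_monom m) (cnj (Poly_Mapping.lookup f m)))"

definition cpolys :: "'a ring \<Rightarrow> nat \<Rightarrow> 'a cpoly set" where
  "cpolys F n = {f. \<forall>m\<in>Poly_Mapping.keys f. \<forall>v\<in>Poly_Mapping.keys m.
     site v < n \<and> label v \<in> carrier F - {\<zero>\<^bsub>F\<^esub>}}"

definition monom_var_degree :: "'a cmonom \<Rightarrow> nat" where
  "monom_var_degree m = card (site ` Poly_Mapping.keys m)"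

text \<open>The inserted \<open>0\<close> only matters for the zero polynomial.\<close>

definition var_degree :: "'a cpoly \<Rightarrow> nat" where
  "var_degree f = Max (insert 0 (monom_var_degree ` Poly_Mapping.keys f))"


subsection \<open>Complex pseudo-expectations\<close>

text \<open>
  The functional \<open>E\<close> is a total function; only its values on polynomials of variable degree at
  most \<open>d\<close> are meaningful. Bounds such as \<open>d - 1\<close> are written additively to avoid truncated
  subtraction.
\<close>

definition complex_pseudo_expectation ::
  "'a ring \<Rightarrow> nat \<Rightarrow> nat \<Rightarrow> ('a cpoly \<Rightarrow> complex) \<Rightarrow> bool" where
  "complex_pseudo_expectation F n d E \<longleftrightarrow>
     (\<forall>f\<in>cpolys F n. \<forall>g\<in>cpolys F n. var_degree f \<le> d \<longrightarrow> var_degree g \<le> d \<longrightarrow>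
        E (f + g) = E f + E g) \<and>
     (\<forall>c. \<forall>f\<in>cpolys F n. var_degree f \<le> d \<longrightarrow> E (const_poly c * f) = c * E f) \<and>
     E 1 = 1 \<and>
     (\<forall>f\<in>cpolys F n. 2 * var_degree f \<le> d \<longrightarrow> E (f * conj_poly f) \<in> \<real>\<^sub>\<ge>\<^sub>0) \<and>
     (\<forall>i<n. \<forall>\<alpha>\<in>carrier F. \<forall>f\<in>cpolys F n. var_degree f + 1 \<le> d \<longrightarrow>
        E (f * (y_poly F i \<alpha> ^ field_char F - 1)) = 0) \<and>
     (\<forall>i<n. \<forall>\<alpha>\<in>carrier F. \<forall>\<beta>\<in>carrier F. \<forall>f\<in>cpolys F n. var_degree f + 2 \<le> d \<longrightarrow>
        E (f * (y_poly F i \<alpha> * ybar_poly F i \<beta> - y_poly F i (\<alpha> \<ominus>\<^bsub>F\<^esub> \<beta>))) = 0)"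

definition satisfies_klin ::
  "'a ring \<Rightarrow> nat \<Rightarrow> ('a cpoly \<Rightarrow> complex) \<Rightarrow> 'a klin \<Rightarrow> bool" where
  "satisfies_klin F n E I \<longleftrightarrow> (case I of (H, b) \<Rightarrow>
     \<forall>v\<in>H. \<forall>\<beta>\<in>carrier F - {\<zero>\<^bsub>F\<^esub>}.
       E (\<Prod>i\<in>supp F n v. y_poly F i (\<beta> \<otimes>\<^bsub>F\<^esub> v i))
         = omega (field_char F) ^ trace_rep F (\<beta> \<otimes>\<^bsub>F\<^esub> b v))"

end

theory Submission
  imports Defs "HOL-Algebra.Multiplicative_Group" "HOL-Algebra.Sylow"
begin

text \<open>
  Part 1 is Hoeffding's inequality for each assignment and a union bound over all assignments.

  For part 2, a monomial is reduced to its exponent vector in \<open>F\<^sup>n\<close>, and the pseudo-expectation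
  of the monomial is \<open>\<omega>\<^sub>p ^ Tr b\<close> if this vector is a combination, with right-hand side \<open>b\<close>, of
  fewer than \<open>s\<close> equations, and \<open>0\<close> otherwise. This is well defined and positive semidefinite as
  soon as no combination of at most \<open>2s\<close> equations vanishes and every combination of between \<open>s\<close>
  and \<open>2s\<close> equations has weight greater than the degree.

  A combination of \<open>s\<close> equations that violates this is, after rescaling, a sequence of \<open>s\<close>
  \<open>k\<close>-sparse vectors whose sum \<open>w\<close> has low weight, that is, a walk of \<open>ks\<close> single-coordinate steps
  that returns close to the origin. The potential \<open>\<theta> ^ |w|\<close> with \<open>\<theta>\<^sup>2 = ks / (nq)\<close> grows by at most a
  factor \<open>3 sqrt (ksnq)\<close> per step, which bounds the number of such walks; compared with the
  probability \<open>(m / |V|)\<^sup>s\<close> that \<open>s\<close> given vectors are all chosen, where \<open>V\<close> is the set of all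
  \<open>k\<close>-sparse vectors, the expected number of violations with \<open>s\<close> equations is at most
  \<open>(R sqrt (s / l))\<^sup>s\<close>. Cancelling a coordinate costs a factor \<open>q\<close> here, which is why the
  degree does not deteriorate with the field size.
\<close>

text \<open>Sizes of derivations add up, so vectors derived from fewer than \<open>s\<close>
  equations are not closed under addition. The gap between \<open>s\<close> and \<open>2s\<close>
  restores closure where it matters: a sum of two derivations has fewer than \<open>2s\<close>
  equations, and if its weight is low it has fewer than \<open>s\<close> again. This is the
  transitivity behind positivity. It concerns \<open>H\<close> alone, so part 2 holds for every
  choice of right-hand sides; their randomness serves part 1. The value of \<open>\<theta>\<close>
  balances cancelling steps, worth \<open>1/\<theta>\<close> on at most \<open>ks\<close> sites,
  against growing steps, worth \<open>q\<theta>\<close> on \<open>n\<close> sites. With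
  \<open>m\<close> of order \<open>n (nq/l)^(k/2-1)\<close> all powers of \<open>nq\<close> cancel
  in the expected number of violations, and the base left is \<open>(s/l)^(k/2-1)\<close> up to a
  constant, which \<open>k \<ge> 3\<close> bounds by \<open>sqrt (s/l)\<close>. Allowing weight
  \<open>D\<close> costs \<open>\<theta>^(-D)\<close>, at most \<open>(nq)^D\<close>. Hence
  \<open>D = s / ln (qn)\<close> costs only \<open>e^s\<close>, and this is the one logarithm lost
  in the degree. For \<open>s\<close> up to a small multiple of \<open>l\<close> the sum over
  \<open>s\<close> is dominated by its first term, of order \<open>1 / sqrt l\<close>, and
  \<open>l \<ge> ln (qn)\<close> tends to infinity.\<close>

no_notation HLD_nxt (infixr "\<cdot>" 65)

subsection \<open>The trace character of a finite field\<close>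

text \<open>Needed for the exponent \<open>p\<close>, where it makes Frobenius additive. The
  induction is Pascal's rule.\<close>

lemma (in cring) binomial_expansion:
  assumes x: "x \<in> carrier R" and y: "y \<in> carrier R"
  shows "(x \<oplus> y) [^] (n::nat) =
    (\<Oplus>i\<in>{..n}. [(n choose i)] \<cdot> (x [^] i \<otimes> y [^] (n - i)))"
proof (induction n)
  case 0
  then show ?case by (simp add: add.nat_pow_0)
next
  case (Suc n)
  let ?f = "\<lambda>i. x [^] Suc i \<otimes> y [^] (n - i)"
  let ?g = "\<lambda>i. x [^] i \<otimes> y [^] (Suc n - i)"
  note xy = x y
  have "(x \<oplus> y) [^] Suc n =
      (\<Oplus>i\<in>{..n}. [(n choose i)] \<cdot> (x [^] i \<otimes> y [^] (n - i))) \<otimes> (x \<oplus> y)"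
    using Suc by simp
  also have "\<dots> = (\<Oplus>i\<in>{..n}. [(n choose i)] \<cdot> (x [^] i \<otimes> y [^] (n - i)) \<otimes> (x \<oplus> y))"
    using xy by (intro finsum_ldistr) auto
  also have "\<dots> = (\<Oplus>i\<in>{..n}. [(n choose i)] \<cdot> ?f i \<oplus> [(n choose i)] \<cdot> ?g i)"
  proof (rule finsum_cong')
    fix i assume i: "i \<in> {..n}"
    have "x [^] i \<otimes> y [^] (n - i) \<otimes> x = ?f i"
      using xy by (simp add: m_ac)
    moreover have "x [^] i \<otimes> y [^] (n - i) \<otimes> y = ?g i"
      using xy i by (simp add: m_ac Suc_diff_le)
    ultimately show "[(n choose i)] \<cdot> (x [^] i \<otimes> y [^] (n - i)) \<otimes> (x \<oplus> y) =
        [(n choose i)] \<cdot> ?f i \<oplus> [(n choose i)] \<cdot> ?g i"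
      using xy by (simp add: r_distr add_pow_ldistr)
  qed (use xy in auto)
  also have "\<dots> = (\<Oplus>i\<in>{..n}. [(n choose i)] \<cdot> ?f i) \<oplus> (\<Oplus>i\<in>{..n}. [(n choose i)] \<cdot> ?g i)"
    using xy by (intro finsum_addf) auto
  \<comment> \<open>The added top term has coefficient \<open>n choose Suc n = 0\<close>. Splitting
    off index 0 then turns \<open>?g (Suc i)\<close> into \<open>?f i\<close>, which aligns the two
    sums.\<close>
  also have "(\<Oplus>i\<in>{..n}. [(n choose i)] \<cdot> ?g i) = (\<Oplus>i\<in>{..Suc n}. [(n choose i)] \<cdot> ?g i)"
    using xy by (subst finsum_Suc) (auto simp: binomial_eq_0 add.nat_pow_0)
  also have "\<dots> = (\<Oplus>i\<in>{..n}. [(n choose Suc i)] \<cdot> ?f i) \<oplus> ?g 0"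
    using xy by (subst finsum_Suc2) (auto simp: add.nat_pow_eone)
  also have "(\<Oplus>i\<in>{..n}. [(n choose i)] \<cdot> ?f i) \<oplus> ((\<Oplus>i\<in>{..n}. [(n choose Suc i)] \<cdot> ?f i) \<oplus> ?g 0) =
      (\<Oplus>i\<in>{..n}. [(n choose i)] \<cdot> ?f i \<oplus> [(n choose Suc i)] \<cdot> ?f i) \<oplus> ?g 0"
    using xy by (subst finsum_addf) (auto simp: a_assoc)
  also have "\<dots> = (\<Oplus>i\<in>{..n}. [(Suc n choose Suc i)] \<cdot> ?f i) \<oplus> ?g 0"
    using xy by (intro arg_cong2[where f = "add R"] finsum_cong')
      (auto simp: add.nat_pow_mult)
  also have "\<dots> = (\<Oplus>i\<in>{..Suc n}. [(Suc n choose i)] \<cdot> ?g i)"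
    using xy by (subst finsum_Suc2) auto
  finally show ?case .
qed

locale finite_field = field F for F :: "'a ring" (structure) +
  assumes finite_carrier: "finite (carrier F)"
begin


abbreviation "p \<equiv> field_char F"

lemma card_carrier_gt_1: "1 < card (carrier F)"
proof -
  have "card {\<zero>, \<one>} \<le> card (carrier F)"
    by (intro card_mono finite_carrier) auto
  then show ?thesis by simp
qed

text \<open>The \<open>LEAST\<close> in \<open>field_char\<close> has a witness: by Lagrange the
  order of the additive group annihilates \<open>\<one>\<close>.\<close>

lemma field_char_props: "0 < p" "[p] \<cdot> \<one> = \<zero>"
proof -
  have "group.ord (add_monoid F) \<one> dvd order (add_monoid F)"
    by (intro add.ord_dvd_group_order) (auto)
  then have "[(order (add_monoid F))] \<cdot> \<one> = \<zero>"
    using add.pow_eq_id by simp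
  moreover have "order (add_monoid F) > 0"
    using card_carrier_gt_1 by (simp add: order_def)
  ultimately have "0 < p \<and> [p] \<cdot> \<one> = \<zero>"
    unfolding field_char_def by (intro LeastI) auto
  then show "0 < p" "[p] \<cdot> \<one> = \<zero>" by auto
qed

lemma field_char_minimal: "0 < j \<Longrightarrow> j < p \<Longrightarrow> [j] \<cdot> \<one> \<noteq> \<zero>"
  using not_less_Least[of j "\<lambda>p. 0 < p \<and> [p] \<cdot> \<one> = \<zero>"] unfolding field_char_def by auto

lemma nat_embed_mult: "[(m * n)] \<cdot> \<one> = [m] \<cdot> \<one> \<otimes> [n] \<cdot> \<one>" for m n :: nat
  by (simp add: add_pow_ldistr add.nat_pow_pow mult.commute)

lemma nat_embed_mod: "[(n mod p)] \<cdot> \<one> = [n] \<cdot> \<one>"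
proof -
  have "[n] \<cdot> \<one> = [(p * (n div p) + n mod p)] \<cdot> \<one>" by simp
  also have "\<dots> = [(p * (n div p))] \<cdot> \<one> \<oplus> [(n mod p)] \<cdot> \<one>"
    by (simp only: add.nat_pow_mult one_closed)
  also have "[(p * (n div p))] \<cdot> \<one> = \<zero>"
    by (simp add: nat_embed_mult field_char_props)
  finally show ?thesis by simp
qed

lemma field_char_prime: "prime p"
proof (rule prime_natI)
  have "p \<noteq> 1" using field_char_props by (auto simp: add.nat_pow_eone)
  then show "p \<ge> 2" using field_char_props by linarith
  fix m n assume "p dvd m * n"
  then have "[m] \<cdot> \<one> \<otimes> [n] \<cdot> \<one> = \<zero>"
    using nat_embed_mod[of "m * n"] by (simp add: nat_embed_mult add.nat_pow_0 mod_eq_0_iff_dvd)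
  then have "[(m mod p)] \<cdot> \<one> = \<zero> \<or> [(n mod p)] \<cdot> \<one> = \<zero>"
    by (simp add: nat_embed_mod integral_iff)
  then show "p dvd m \<or> p dvd n"
    using field_char_minimal[of "m mod p"] field_char_minimal[of "n mod p"] field_char_props(1)
    by (meson mod_less_divisor mod_greater_zero_iff_not_dvd)
qed

lemma field_char_gt_1: "1 < p"
  using field_char_prime by (rule prime_gt_1_nat)

lemma char_times_eq_zero: "x \<in> carrier F \<Longrightarrow> [p] \<cdot> x = \<zero>"
  using add_pow_ldistr[of \<one> x p] by (simp add: field_char_props)

lemma char_dvd_times_eq_zero: "x \<in> carrier F \<Longrightarrow> p dvd n \<Longrightarrow> [n] \<cdot> x = \<zero>"
  by (auto simp: char_times_eq_zero simp flip: add.nat_pow_pow)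

text \<open>Sylow's theorem with exponent 1 serves as Cauchy's theorem: a prime \<open>r\<close>
  dividing the order yields a nonzero \<open>x\<close> whose additive order divides both
  \<open>r\<close> and \<open>p\<close>, so \<open>r = p\<close>. This makes the \<open>THE\<close>
  in \<open>prime_degree\<close> meaningful.\<close>

lemma card_carrier_prime_power: "\<exists>e. card (carrier F) = p ^ e"
proof -
  let ?N = "card (carrier F)"
  have eq: "r = p" if r: "prime r" "r dvd ?N" for r
  proof -
    obtain m where m: "?N = r ^ 1 * m" using r by auto
    have "\<exists>H. subgroup H (add_monoid F) \<and> card H = r ^ 1"
      using sylow_thm[OF r(1) a_group, of 1 m] m finite_carrier by (simp add: order_def)
    then obtain H where H: "subgroup H (add_monoid F)" "card H = r" by auto
    have "H \<noteq> {\<zero>}" using H(2) prime_gt_1_nat[OF r(1)] by auto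
    then obtain x where x: "x \<in> H" "x \<noteq> \<zero>"
      using subgroup.one_closed[OF H(1)] by auto
    interpret HG: group "add_monoid F\<lparr>carrier := H\<rparr>"
      by (rule subgroup.subgroup_is_group[OF H(1) add.group_axioms])
    have xF: "x \<in> carrier F" using subgroup.subset[OF H(1)] x by auto
    have "x [^]\<^bsub>add_monoid F\<lparr>carrier := H\<rparr>\<^esub> order (add_monoid F\<lparr>carrier := H\<rparr>) = \<zero>"
      using HG.ord_dvd_group_order[of x] HG.pow_eq_id[of x] x by simp
    then have "[r] \<cdot> x = \<zero>"
      using H(2) by (simp add: order_def add_pow_def nat_pow_def)
    then have "add.ord x dvd r" using add.pow_eq_id[OF xF, of r] by simp
    moreover have "add.ord x dvd p"
      using add.pow_eq_id[OF xF, of p] char_times_eq_zero[OF xF] by simp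
    moreover have "add.ord x \<noteq> 1" using add.ord_eq_1[OF xF] x by simp
    ultimately show ?thesis
      using r(1) field_char_prime by (metis prime_nat_iff)
  qed
  have "?N = (\<Prod>r\<in>prime_factors ?N. r ^ multiplicity r ?N)"
    using card_carrier_gt_1 by (intro prime_factorization_nat) auto
  moreover have "prime_factors ?N \<subseteq> {p}"
    using eq by (auto simp: in_prime_factors_iff)
  ultimately obtain A where A: "A \<subseteq> {p}" "?N = (\<Prod>r\<in>A. r ^ multiplicity r ?N)"
    by blast
  from A(1) have "A = {} \<or> A = {p}" by blast
  then show ?thesis
  proof
    assume "A = {}"
    then have "?N = p ^ 0" using A(2) by simp
    then show ?thesis by blast
  next
    assume "A = {p}"
    then have "?N = p ^ multiplicity p ?N" using A(2) by simp
    then show ?thesis by blast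
  qed
qed

lemma card_carrier_eq: "card (carrier F) = p ^ prime_degree F"
proof -
  obtain e where e: "card (carrier F) = p ^ e" using card_carrier_prime_power by auto
  have "prime_degree F = e"
    unfolding prime_degree_def using e field_char_gt_1
    by (intro the_equality) (auto simp: power_inject_exp)
  then show ?thesis using e by simp
qed

section \<open>Frobenius and the trace to the prime field\<close>

lemma frobenius_add:
  assumes x: "x \<in> carrier F" and y: "y \<in> carrier F"
  shows "(x \<oplus> y) [^] p = x [^] p \<oplus> y [^] p"
proof -
  have "(x \<oplus> y) [^] p = (\<Oplus>i\<in>{..p}. [(p choose i)] \<cdot> (x [^] i \<otimes> y [^] (p - i)))"
    by (rule binomial_expansion[OF x y])
  also have "\<dots> = (\<Oplus>i\<in>{0, p}. [(p choose i)] \<cdot> (x [^] i \<otimes> y [^] (p - i)))"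
  proof (rule add.finprod_mono_neutral_cong_left[symmetric])
    fix i assume i: "i \<in> {..p} - {0, p}"
    have "p dvd (p choose i)"
      by (rule dvd_choose_prime) (use i field_char_prime in auto)
    then show "[(p choose i)] \<cdot> (x [^] i \<otimes> y [^] (p - i)) = \<zero>"
      using x y by (intro char_dvd_times_eq_zero) auto
  qed (use x y in auto)
  also have "\<dots> = x [^] p \<oplus> y [^] p"
    using x y field_char_gt_1 by (subst finsum_insert) (auto simp: add.nat_pow_eone a_comm)
  finally show ?thesis .
qed

lemma frobenius_pow_add:
  assumes "x \<in> carrier F" "y \<in> carrier F"
  shows "(x \<oplus> y) [^] (p ^ j) = x [^] (p ^ j) \<oplus> y [^] (p ^ j)"
proof (induction j)
  case (Suc j)
  have *: "z [^] (p ^ Suc j) = (z [^] (p ^ j)) [^] p" if "z \<in> carrier F" for z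
    using that by (simp add: nat_pow_pow mult.commute)
  show ?case
    using assms by (simp only: * a_closed Suc) (simp add: frobenius_add)
qed (use assms in auto)

lemma frobenius_finsum:
  assumes "finite A" "f \<in> A \<rightarrow> carrier F"
  shows "(\<Oplus>i\<in>A. f i) [^] p = (\<Oplus>i\<in>A. f i [^] p)"
  using assms
proof (induction A rule: finite_induct)
  case empty
  show ?case using field_char_gt_1 by (simp add: nat_pow_zero)
next
  case (insert a A)
  then show ?case by (simp add: finsum_insert frobenius_add Pi_iff)
qed

lemma pow_card_carrier: "x \<in> carrier F \<Longrightarrow> x [^] card (carrier F) = x"
proof (cases "x = \<zero>")
  case True
  then show ?thesis using card_carrier_gt_1 by (simp add: nat_pow_zero)
next
  case False
  assume x: "x \<in> carrier F"
  interpret M: group "mult_of F" by (rule field_mult_group)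
  have "x [^]\<^bsub>mult_of F\<^esub> order (mult_of F) = \<one>\<^bsub>mult_of F\<^esub>"
    using M.ord_dvd_group_order[of x] M.pow_eq_id[of x] x False by simp
  then have "x [^] (card (carrier F) - 1) = \<one>"
    using finite_carrier by (simp add: order_mult_of order_def nat_pow_mult_of)
  then have "x [^] Suc (card (carrier F) - 1) = x"
    using x by simp
  then show ?thesis using card_carrier_gt_1 by simp
qed

lemma field_trace_closed: "x \<in> carrier F \<Longrightarrow> field_trace F x \<in> carrier F"
  unfolding field_trace_def by (intro finsum_closed) auto

lemma field_trace_add:
  "x \<in> carrier F \<Longrightarrow> y \<in> carrier F \<Longrightarrow>
    field_trace F (x \<oplus> y) = field_trace F x \<oplus> field_trace F y"
  unfolding field_trace_def
  by (simp add: frobenius_pow_add finsum_addf Pi_iff)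

text \<open>Frobenius permutes the conjugates cyclically: the last one is sent to
  \<open>x ^ |F| = x\<close>, the first.\<close>

lemma field_trace_frobenius:
  assumes x: "x \<in> carrier F"
  shows "field_trace F x [^] p = field_trace F x"
proof -
  have "prime_degree F \<noteq> 0"
    using card_carrier_eq card_carrier_gt_1 by (metis less_irrefl power_0)
  then obtain e where e: "prime_degree F = Suc e" by (cases "prime_degree F") auto
  have "field_trace F x [^] p = (\<Oplus>j\<in>{..e}. x [^] (p ^ Suc j))"
    unfolding field_trace_def e lessThan_Suc_atMost using x
    by (simp add: frobenius_finsum nat_pow_pow mult.commute Pi_iff)
  also have "\<dots> = (\<Oplus>j\<in>{..<e}. x [^] (p ^ Suc j)) \<oplus> x"
    using x pow_card_carrier[OF x] card_carrier_eq e
    by (cases e) (auto simp: a_comm lessThan_Suc_atMost)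
  also have "\<dots> = (\<Oplus>j\<in>{..e}. x [^] (p ^ j))"
    using x by (cases e) (auto simp: finsum_Suc2 lessThan_Suc_atMost simp del: finsum_Suc)
  finally show ?thesis unfolding field_trace_def e lessThan_Suc_atMost .
qed

lemma nat_embed_inj: "inj_on (\<lambda>r. [r] \<cdot> \<one>) {..<p}"
proof -
  have "r = s" if "[r] \<cdot> \<one> = [s] \<cdot> \<one>" "r \<le> s" "s < p" for r s :: nat
  proof -
    have "[r] \<cdot> \<one> \<oplus> [(s - r)] \<cdot> \<one> = [s] \<cdot> \<one>"
      by (subst add.nat_pow_mult) (use that in auto)
    then have "[r] \<cdot> \<one> \<oplus> [(s - r)] \<cdot> \<one> = [r] \<cdot> \<one>" using that(1) by metis
    then have "[(s - r)] \<cdot> \<one> = \<zero>"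
      using add.l_cancel_one[of "[r] \<cdot> \<one>" "[(s - r)] \<cdot> \<one>"] by simp
    then show ?thesis using field_char_minimal[of "s - r"] that by (cases "s - r > 0") auto
  qed
  then show ?thesis
    by (intro inj_onI) (metis lessThan_iff nat_le_linear)
qed

lemma nat_embed_frobenius: "([r] \<cdot> \<one>) [^] p = [r] \<cdot> \<one>" for r :: nat
proof (induction r)
  case 0
  then show ?case using field_char_gt_1 by (simp add: add.nat_pow_0 nat_pow_zero)
next
  case (Suc r)
  then show ?case by (simp add: add.nat_pow_Suc frobenius_add)
qed

text \<open>Nonzero fixed points satisfy \<open>x ^ (p - 1) = 1\<close>. This equation has at most
  \<open>p - 1\<close> solutions in a field, and the nonzero multiples of \<open>\<one>\<close>
  already provide that many.\<close>

lemma frobenius_fixed_in_prime_field: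
  assumes x: "x \<in> carrier F" "x [^] p = x"
  shows "\<exists>r<p. [r] \<cdot> \<one> = x"
proof (cases "x = \<zero>")
  case True
  then show ?thesis using field_char_props by (intro exI[of _ 0]) (auto simp: add.nat_pow_0)
next
  case False
  let ?A = "{x \<in> carrier F. x [^] (p - 1) = \<one>}"
  have mem: "y \<in> ?A" if "y \<in> carrier F" "y [^] p = y" "y \<noteq> \<zero>" for y
  proof -
    have "y [^] Suc (p - 1) = y" using that field_char_gt_1 by simp
    then have "y [^] (p - 1) \<otimes> y = \<one> \<otimes> y" using that by simp
    then have "y [^] (p - 1) = \<one>" using that m_rcancel[of y "y [^] (p - 1)" \<one>] by auto
    then show ?thesis using that by simp
  qed
  have "(\<lambda>r. [r] \<cdot> \<one>) ` {1..<p} \<subseteq> ?A"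
  proof (rule image_subsetI)
    fix r assume "r \<in> {1..<p}"
    then show "[r] \<cdot> \<one> \<in> ?A"
      using mem[of "[r] \<cdot> \<one>"] field_char_minimal[of r] nat_embed_frobenius[of r] by auto
  qed
  moreover have "card ?A \<le> card ((\<lambda>r. [r] \<cdot> \<one>) ` {1..<p})"
  proof -
    have "card ?A \<le> p - 1"
      using num_roots_le_deg[OF finite_carrier] field_char_gt_1 by simp
    also have "\<dots> = card ((\<lambda>r. [r] \<cdot> \<one>) ` {1..<p})"
      by (subst card_image) (auto intro: inj_on_subset[OF nat_embed_inj])
    finally show ?thesis .
  qed
  ultimately have "(\<lambda>r. [r] \<cdot> \<one>) ` {1..<p} = ?A"
    using finite_carrier by (intro card_seteq) auto
  moreover have "x \<in> ?A" using mem x False by simp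
  ultimately have "x \<in> (\<lambda>r. [r] \<cdot> \<one>) ` {1..<p}" by simp
  then show ?thesis by auto
qed

text \<open>Discharges the \<open>THE\<close> in \<open>trace_rep\<close>: the trace is fixed by
  Frobenius, hence is a multiple of \<open>\<one>\<close>, and the multiples below \<open>p\<close>
  are distinct.\<close>

lemma trace_rep_props:
  assumes "x \<in> carrier F"
  shows "trace_rep F x < p" "[(trace_rep F x)] \<cdot> \<one> = field_trace F x"
proof -
  obtain r where r: "r < p" "[r] \<cdot> \<one> = field_trace F x"
    using frobenius_fixed_in_prime_field field_trace_closed field_trace_frobenius assms by blast
  have "trace_rep F x = r"
    unfolding trace_rep_def using r nat_embed_inj
    by (intro the_equality) (auto simp: inj_on_def)
  then show "trace_rep F x < p" "[(trace_rep F x)] \<cdot> \<one> = field_trace F x" using r by auto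
qed

section \<open>The trace as an additive character into the unit circle\<close>

lemma omega_power_char: "omega p ^ p = 1"
  using field_char_gt_1 by (simp add: omega_def flip: exp_of_nat_mult)

lemma omega_power_mod: "omega p ^ (n mod p) = omega p ^ n"
proof -
  have "omega p ^ n = omega p ^ (p * (n div p) + n mod p)" by simp
  also have "\<dots> = omega p ^ (n mod p)"
    by (simp only: power_add power_mult omega_power_char) simp
  finally show ?thesis by simp
qed

definition trace_character :: "'a \<Rightarrow> complex" where
  "trace_character x = omega p ^ trace_rep F x"

lemma trace_character_add:
  assumes "x \<in> carrier F" "y \<in> carrier F"
  shows "trace_character (x \<oplus> y) = trace_character x * trace_character y"
proof -
  have "[((trace_rep F x + trace_rep F y) mod p)] \<cdot> \<one> = [(trace_rep F (x \<oplus> y))] \<cdot> \<one>"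
    using assms
    by (simp only: nat_embed_mod trace_rep_props field_trace_add a_closed one_closed
        add.nat_pow_mult[symmetric])
  then have "(trace_rep F x + trace_rep F y) mod p = trace_rep F (x \<oplus> y)"
    using trace_rep_props(1)[of "x \<oplus> y"] assms field_char_gt_1
    by (intro inj_onD[OF nat_embed_inj]) auto
  then have "omega p ^ trace_rep F (x \<oplus> y) = omega p ^ (trace_rep F x + trace_rep F y)"
    using omega_power_mod[of "trace_rep F x + trace_rep F y"] by simp
  then show ?thesis by (simp add: trace_character_def power_add)
qed

lemma norm_trace_character: "norm (trace_character x) = 1"
proof -
  have "norm (omega p) = 1"
    by (simp only: omega_def norm_exp_eq_Re Re_divide_of_nat) simp
  then show ?thesis by (simp add: trace_character_def norm_power)
qed

lemma trace_character_zero: "trace_character \<zero> = 1"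
proof -
  have "trace_character \<zero> = trace_character \<zero> * trace_character \<zero>"
    using trace_character_add[of \<zero> \<zero>] by simp
  moreover have "trace_character \<zero> \<noteq> 0" using norm_trace_character[of \<zero>] by auto
  ultimately show ?thesis by simp
qed

lemma trace_character_minus:
  assumes "x \<in> carrier F"
  shows "trace_character (\<ominus> x) = cnj (trace_character x)"
proof -
  have "trace_character x * trace_character (\<ominus> x) = 1"
    using assms trace_character_add[of x "\<ominus> x"] by (simp add: r_neg trace_character_zero)
  moreover have "trace_character x * cnj (trace_character x) = 1"
    by (simp add: complex_norm_square[symmetric] norm_trace_character)
  ultimately show ?thesis
    by (metis mult_cancel_left mult_zero_left zero_neq_one)
qed

end

subsection \<open>Linear functionals on polynomials\<close>

text \<open>Extending linearly from monomials makes additivity and homogeneity hold on all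
  polynomials, whatever their degree.\<close>

definition linear_ext :: "('a cmonom \<Rightarrow> complex) \<Rightarrow> 'a cpoly \<Rightarrow> complex" where
  "linear_ext \<psi> f = (\<Sum>m\<in>Poly_Mapping.keys f. Poly_Mapping.lookup f m * \<psi> m)"

lemma linear_ext_superset:
  assumes "finite A" "Poly_Mapping.keys f \<subseteq> A"
  shows "linear_ext \<psi> f = (\<Sum>m\<in>A. Poly_Mapping.lookup f m * \<psi> m)"
  unfolding linear_ext_def using assms
  by (intro sum.mono_neutral_left) (auto simp: in_keys_iff)

lemma linear_ext_add: "linear_ext \<psi> (f + g) = linear_ext \<psi> f + linear_ext \<psi> g"
proof -
  let ?A = "Poly_Mapping.keys f \<union> Poly_Mapping.keys g"
  have "linear_ext \<psi> (f + g) = (\<Sum>m\<in>?A. Poly_Mapping.lookup (f + g) m * \<psi> m)"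
    by (intro linear_ext_superset) (auto simp: Poly_Mapping.keys_add)
  also have "\<dots> = linear_ext \<psi> f + linear_ext \<psi> g"
    by (simp add: linear_ext_superset[of ?A f] linear_ext_superset[of ?A g]
        lookup_add ring_distribs sum.distrib)
  finally show ?thesis .
qed

lemma linear_ext_single: "linear_ext \<psi> (Poly_Mapping.single m c) = c * \<psi> m"
  by (simp add: linear_ext_def)

lemma linear_ext_sum: "linear_ext \<psi> (\<Sum>a\<in>A. f a) = (\<Sum>a\<in>A. linear_ext \<psi> (f a))"
  by (induction A rule: infinite_finite_induct) (auto simp: linear_ext_add, simp_all add: linear_ext_def)

lemma linear_ext_minus: "linear_ext \<psi> (f - g) = linear_ext \<psi> f - linear_ext \<psi> g"
  using linear_ext_add[of \<psi> "f - g" g] by simp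

lemma sum_of_monomials:
  "f = (\<Sum>m\<in>Poly_Mapping.keys f. Poly_Mapping.single m (Poly_Mapping.lookup f m))"
  by (rule poly_mapping_eqI) (simp add: lookup_sum lookup_single when_def in_keys_iff)

lemma linear_ext_mult_single:
  "linear_ext \<psi> (f * Poly_Mapping.single M c) =
    (\<Sum>m\<in>Poly_Mapping.keys f. Poly_Mapping.lookup f m * c * \<psi> (m + M))"
proof -
  have "f * Poly_Mapping.single M c =
      (\<Sum>m\<in>Poly_Mapping.keys f. Poly_Mapping.single (m + M) (Poly_Mapping.lookup f m * c))"
    by (subst (1) sum_of_monomials[of f]) (simp add: sum_distrib_right mult_single)
  then show ?thesis by (simp add: linear_ext_sum linear_ext_single)
qed

lemma linear_ext_const_mult: "linear_ext \<psi> (const_poly c * f) = c * linear_ext \<psi> f"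
  by (simp add: const_poly_def mult.commute[of _ f] linear_ext_mult_single)
     (simp add: linear_ext_def sum_distrib_left mult_ac)

text \<open>Turns positivity on squares into positive semidefiniteness of the kernel
  \<open>\<psi> (m + conj_monom m')\<close> on the monomials of \<open>f\<close>.\<close>

lemma linear_ext_mult_conj:
  "linear_ext \<psi> (f * conj_poly f) =
    (\<Sum>m\<in>Poly_Mapping.keys f. \<Sum>m'\<in>Poly_Mapping.keys f.
      Poly_Mapping.lookup f m * cnj (Poly_Mapping.lookup f m') * \<psi> (m + conj_monom m'))"
  unfolding conj_poly_def sum_distrib_left linear_ext_sum linear_ext_mult_single
  by (rule sum.swap)

text \<open>
  Where \<open>K\<close> is nonzero it is an equivalence relation, and
  \<open>K a b = (\<Sum>c\<in>A. K a c * cnj (K b c) / N c)\<close> with \<open>N c\<close> the size of the class of \<open>c\<close>.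
\<close>

lemma multiplicative_kernel_nonneg:
  fixes K :: "'i \<Rightarrow> 'i \<Rightarrow> complex" and f :: "'i \<Rightarrow> complex"
  assumes fin: "finite A"
    and diag: "\<And>a. a \<in> A \<Longrightarrow> K a a = 1"
    and herm: "\<And>a b. a \<in> A \<Longrightarrow> b \<in> A \<Longrightarrow> K b a = cnj (K a b)"
    and mult: "\<And>a b c. a \<in> A \<Longrightarrow> b \<in> A \<Longrightarrow> c \<in> A \<Longrightarrow> K a b \<noteq> 0 \<Longrightarrow> K b c \<noteq> 0 \<Longrightarrow>
      K a c = K a b * K b c"
  shows "(\<Sum>a\<in>A. \<Sum>b\<in>A. f a * cnj (f b) * K a b) \<in> \<real>\<^sub>\<ge>\<^sub>0"
proof -
  define N where "N c = card {a\<in>A. K a c \<noteq> 0}" for c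
  have nz: "K a c \<noteq> 0" if "a \<in> A" "b \<in> A" "c \<in> A" "K a b \<noteq> 0" "K b c \<noteq> 0" for a b c
    using mult[OF that] that by simp
  have nz_sym: "K b a \<noteq> 0 \<longleftrightarrow> K a b \<noteq> 0" if "a \<in> A" "b \<in> A" for a b
    using herm[OF that] by simp
  have N_eq: "N c = N a" if "a \<in> A" "c \<in> A" "K a c \<noteq> 0" for a c
    unfolding N_def using that nz nz_sym by (intro arg_cong[where f = card]) blast
  have N_pos: "N a > 0" if "a \<in> A" for a
    unfolding N_def using that fin diag by (intro card_gt_0_iff[THEN iffD2]) auto
  have expand: "K a b = (\<Sum>c\<in>A. K a c * cnj (K b c) / of_nat (N c))" if ab: "a \<in> A" "b \<in> A" for a b
  proof -
    have "K a c * cnj (K b c) / of_nat (N c) =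
        (if K c a \<noteq> 0 then K a b / of_nat (N a) else 0)" if c: "c \<in> A" for c
    proof (cases "K a c = 0")
      case True
      then show ?thesis using herm[OF ab(1) c] by simp
    next
      case ac: False
      have "K a b = K a c * K c b"
      proof (cases "K c b = 0")
        case True
        then have "K a b = 0"
          using nz[OF c ab(1) ab(2)] nz_sym[OF ab(1) c] ac by auto
        then show ?thesis using True by simp
      next
        case False
        then show ?thesis using mult[OF ab(1) c ab(2) ac] by simp
      qed
      then show ?thesis
        using herm[OF ab(2) c] herm[OF ab(1) c] ac N_eq[OF ab(1) c ac] by simp
    qed
    then have "(\<Sum>c\<in>A. K a c * cnj (K b c) / of_nat (N c)) =
        (\<Sum>c\<in>A. if K c a \<noteq> 0 then K a b / of_nat (N a) else 0)"
      by (intro sum.cong) auto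
    also have "\<dots> = of_nat (N a) * (K a b / of_nat (N a))"
      unfolding N_def using fin by (subst sum.inter_filter[symmetric]) auto
    also have "\<dots> = K a b" using N_pos[OF ab(1)] by simp
    finally show ?thesis by simp
  qed
  have "(\<Sum>a\<in>A. \<Sum>b\<in>A. f a * cnj (f b) * K a b) =
      (\<Sum>a\<in>A. \<Sum>b\<in>A. \<Sum>c\<in>A. (f a * K a c) * cnj (f b * K b c) / of_nat (N c))"
  proof (intro sum.cong refl)
    fix a b assume ab: "a \<in> A" "b \<in> A"
    show "f a * cnj (f b) * K a b =
        (\<Sum>c\<in>A. (f a * K a c) * cnj (f b * K b c) / of_nat (N c))"
      by (subst expand[OF ab]) (auto simp: sum_distrib_left mult_ac)
  qed
  also have "\<dots> = (\<Sum>a\<in>A. \<Sum>c\<in>A. \<Sum>b\<in>A. (f a * K a c) * cnj (f b * K b c) / of_nat (N c))"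
    by (rule sum.cong[OF refl], rule sum.swap)
  also have "\<dots> = (\<Sum>c\<in>A. \<Sum>a\<in>A. \<Sum>b\<in>A. (f a * K a c) * cnj (f b * K b c) / of_nat (N c))"
    by (rule sum.swap)
  \<comment> \<open>For fixed \<open>c\<close> the double sum over \<open>a\<close> and
    \<open>b\<close> factors as a number times its conjugate.\<close>
  also have "\<dots> = (\<Sum>c\<in>A. of_real ((norm (\<Sum>a\<in>A. f a * K a c))\<^sup>2 / N c))"
    by (intro sum.cong refl)
       (simp only: of_real_divide complex_norm_square of_real_of_nat_eq cnj_sum sum_product
         sum_divide_distrib)
  also have "\<dots> = of_real (\<Sum>c\<in>A. (norm (\<Sum>a\<in>A. f a * K a c))\<^sup>2 / N c)"
    by simp
  also have "\<dots> \<in> \<real>\<^sub>\<ge>\<^sub>0"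
    by (subst nonneg_Reals_of_real_iff) (intro sum_nonneg, simp)
  finally show ?thesis .
qed

lemma conj_var_involution [simp]: "conj_var (conj_var v) = v"
  by (cases v) auto

lemma site_conj_var [simp]: "site (conj_var v) = site v"
  by (cases v) auto

lemma label_conj_var [simp]: "label (conj_var v) = label v"
  by (cases v) auto

lemma inj_conj_var: "inj_on conj_var A"
  by (metis conj_var_involution inj_onI)

lemma lookup_conj_monom: "Poly_Mapping.lookup (conj_monom m) v = Poly_Mapping.lookup m (conj_var v)"
proof -
  have "Poly_Mapping.lookup (conj_monom m) v =
      (\<Sum>w\<in>Poly_Mapping.keys m. if w = conj_var v then Poly_Mapping.lookup m w else 0)"
    unfolding conj_monom_def lookup_sum lookup_single when_def
    by (intro sum.cong) (auto)
  then show ?thesis by (simp add: in_keys_iff)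
qed

lemma keys_conj_monom: "Poly_Mapping.keys (conj_monom m) = conj_var ` Poly_Mapping.keys m"
  by (force simp: in_keys_iff lookup_conj_monom image_iff)

section \<open>Exponent vectors of monomials\<close>

context finite_field
begin

text \<open>A conjugated variable counts negatively because conjugation is inversion on roots of
  unity.\<close>

fun signed_label :: "'a cvar \<Rightarrow> 'a" where
  "signed_label (Y i \<alpha>) = \<alpha>"
| "signed_label (Ybar i \<alpha>) = \<ominus> \<alpha>"

definition labelled :: "'a cmonom \<Rightarrow> bool" where
  "labelled m \<longleftrightarrow> (\<forall>v\<in>Poly_Mapping.keys m. label v \<in> carrier F)"

text \<open>The exponent vector of a monomial. The variable \<open>Y i \<alpha>\<close> models the
  trace character at \<open>\<alpha> x_i\<close>, so a product of variables at one site depends only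
  on the sum of their signed labels, with multiplicity.\<close>

definition charge :: "'a cmonom \<Rightarrow> nat \<Rightarrow> 'a" where
  "charge m i = (\<Oplus>v\<in>{v\<in>Poly_Mapping.keys m. site v = i}. [Poly_Mapping.lookup m v] \<cdot> signed_label v)"

lemma signed_label_closed: "label v \<in> carrier F \<Longrightarrow> signed_label v \<in> carrier F"
  by (cases v) auto

lemma charge_superset:
  assumes "finite A" "Poly_Mapping.keys m \<subseteq> A" "\<And>v. v \<in> A \<Longrightarrow> label v \<in> carrier F"
  shows "charge m i = (\<Oplus>v\<in>{v\<in>A. site v = i}. [Poly_Mapping.lookup m v] \<cdot> signed_label v)"
  unfolding charge_def using assms
  by (intro add.finprod_mono_neutral_cong_left)
     (auto simp: in_keys_iff add.nat_pow_0 signed_label_closed)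

lemma charge_closed: "labelled m \<Longrightarrow> charge m i \<in> carrier F"
  unfolding charge_def labelled_def by (intro finsum_closed) (auto simp: signed_label_closed)

lemma labelled_add: "labelled m \<Longrightarrow> labelled m' \<Longrightarrow> labelled (m + m')"
  unfolding labelled_def using Poly_Mapping.keys_add[of m m'] by blast

lemma labelled_conj: "labelled m \<Longrightarrow> labelled (conj_monom m)"
  unfolding labelled_def keys_conj_monom by auto

lemma charge_add:
  assumes "labelled m" "labelled m'"
  shows "charge (m + m') i = charge m i \<oplus> charge m' i"
proof -
  let ?A = "Poly_Mapping.keys m \<union> Poly_Mapping.keys m'"
  have *: "label v \<in> carrier F" if "v \<in> ?A" for v
    using that assms by (auto simp: labelled_def)
  have "charge (m + m') i =
      (\<Oplus>v\<in>{v\<in>?A. site v = i}. [(Poly_Mapping.lookup m v + Poly_Mapping.lookup m' v)] \<cdot> signed_label v)"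
    using charge_superset[of ?A "m + m'" i] Poly_Mapping.keys_add[of m m'] *
    by (simp add: lookup_add)
  also have "\<dots> = (\<Oplus>v\<in>{v\<in>?A. site v = i}. [Poly_Mapping.lookup m v] \<cdot> signed_label v \<oplus>
      [Poly_Mapping.lookup m' v] \<cdot> signed_label v)"
    using * by (intro finsum_cong') (auto simp: add.nat_pow_mult signed_label_closed)
  also have "\<dots> = (\<Oplus>v\<in>{v\<in>?A. site v = i}. [Poly_Mapping.lookup m v] \<cdot> signed_label v) \<oplus>
      (\<Oplus>v\<in>{v\<in>?A. site v = i}. [Poly_Mapping.lookup m' v] \<cdot> signed_label v)"
    using * by (intro finsum_addf) (auto simp: signed_label_closed)
  also have "(\<Oplus>v\<in>{v\<in>?A. site v = i}. [Poly_Mapping.lookup m v] \<cdot> signed_label v) = charge m i"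
    using * by (intro charge_superset[symmetric]) auto
  also have "(\<Oplus>v\<in>{v\<in>?A. site v = i}. [Poly_Mapping.lookup m' v] \<cdot> signed_label v) = charge m' i"
    using * by (intro charge_superset[symmetric]) auto
  finally show ?thesis .
qed

lemma charge_zero [simp]: "charge 0 i = \<zero>"
  by (simp add: charge_def)

lemma charge_single:
  assumes "label v \<in> carrier F"
  shows "charge (Poly_Mapping.single v k) i = (if site v = i then [k] \<cdot> signed_label v else \<zero>)"
proof -
  have "{w \<in> {v}. site w = i} = (if site v = i then {v} else {})" by auto
  then show ?thesis
    using charge_superset[of "{v}" "Poly_Mapping.single v k" i] assms
    by (auto simp: signed_label_closed)
qed

lemma charge_conj:
  assumes "labelled m"
  shows "charge (conj_monom m) i = \<ominus> charge m i"
proof -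
  let ?A = "{v\<in>Poly_Mapping.keys m. site v = i}"
  have lab: "label v \<in> carrier F" if "v \<in> ?A" for v
    using that assms by (auto simp: labelled_def)
  have *: "signed_label (conj_var v) = \<ominus> signed_label v" if "v \<in> ?A" for v
    using lab[OF that] by (cases v) auto
  have "{v\<in>conj_var ` Poly_Mapping.keys m. site v = i} = conj_var ` ?A" by auto
  then have "charge (conj_monom m) i =
      (\<Oplus>v\<in>conj_var ` ?A. [Poly_Mapping.lookup m (conj_var v)] \<cdot> signed_label v)"
    unfolding charge_def keys_conj_monom lookup_conj_monom by simp
  also have "\<dots> = (\<Oplus>v\<in>?A. [Poly_Mapping.lookup m v] \<cdot> (\<ominus> signed_label v))"
    using lab by (subst finsum_reindex) (auto simp: inj_conj_var signed_label_closed * intro!: finsum_cong')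
  finally have eq: "charge (conj_monom m) i = \<dots>" .
  have "charge (conj_monom m) i \<oplus> charge m i =
      (\<Oplus>v\<in>?A. [Poly_Mapping.lookup m v] \<cdot> (\<ominus> signed_label v) \<oplus> [Poly_Mapping.lookup m v] \<cdot> signed_label v)"
    unfolding eq unfolding charge_def
    using lab by (intro finsum_addf[symmetric]) (auto simp: signed_label_closed)
  also have "\<dots> = (\<Oplus>v\<in>?A. \<zero>)"
  proof (rule finsum_cong')
    fix v assume "v \<in> ?A"
    then have c: "signed_label v \<in> carrier F" using lab signed_label_closed by blast
    then have "[k] \<cdot> (\<ominus> signed_label v) \<oplus> [k] \<cdot> signed_label v = [k] \<cdot> (\<ominus> signed_label v \<oplus> signed_label v)" for k :: nat
      by (simp only: add.nat_pow_distrib a_inv_closed)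
    then show "[Poly_Mapping.lookup m v] \<cdot> (\<ominus> signed_label v) \<oplus> [Poly_Mapping.lookup m v] \<cdot> signed_label v = \<zero>"
      using c by (simp add: l_neg)
  qed auto
  also have "\<dots> = \<zero>" by (intro finsum_zero)
  finally show ?thesis
    using assms charge_closed labelled_conj by (metis minus_equality)
qed

text \<open>Links weights of vectors to variable degree. The inclusion may be strict, since labels
  at one site can cancel.\<close>

lemma supp_charge: "supp F n (charge m) \<subseteq> site ` Poly_Mapping.keys m"
proof
  fix i assume i: "i \<in> supp F n (charge m)"
  have "charge m i \<noteq> \<zero>" using i by (simp add: supp_def)
  then have "{v \<in> Poly_Mapping.keys m. site v = i} \<noteq> {}"
    unfolding charge_def by (metis finsum_empty)
  then show "i \<in> site ` Poly_Mapping.keys m" by blast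
qed

lemma card_supp_charge: "card (supp F n (charge m)) \<le> monom_var_degree m"
  unfolding monom_var_degree_def by (intro card_mono supp_charge) simp

lemma cpolys_labelled: "f \<in> cpolys F n \<Longrightarrow> m \<in> Poly_Mapping.keys f \<Longrightarrow> labelled m"
  unfolding cpolys_def labelled_def by blast

definition y_monom :: "nat \<Rightarrow> 'a \<Rightarrow> 'a cmonom" where
  "y_monom i \<alpha> = (if \<alpha> = \<zero> then 0 else Poly_Mapping.single (Y i \<alpha>) 1)"

definition ybar_monom :: "nat \<Rightarrow> 'a \<Rightarrow> 'a cmonom" where
  "ybar_monom i \<alpha> = (if \<alpha> = \<zero> then 0 else Poly_Mapping.single (Ybar i \<alpha>) 1)"

lemma y_poly_eq: "y_poly F i \<alpha> = Poly_Mapping.single (y_monom i \<alpha>) 1"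
  by (simp add: y_poly_def y_monom_def var_poly_def)

lemma ybar_poly_eq: "ybar_poly F i \<alpha> = Poly_Mapping.single (ybar_monom i \<alpha>) 1"
  by (simp add: ybar_poly_def ybar_monom_def var_poly_def)

lemma labelled_y_monom: "\<alpha> \<in> carrier F \<Longrightarrow> labelled (y_monom i \<alpha>)"
  and labelled_ybar_monom: "\<alpha> \<in> carrier F \<Longrightarrow> labelled (ybar_monom i \<alpha>)"
  by (auto simp: labelled_def y_monom_def ybar_monom_def)

lemma charge_y_monom: "\<alpha> \<in> carrier F \<Longrightarrow> charge (y_monom i \<alpha>) j = (if i = j then \<alpha> else \<zero>)"
  by (simp add: y_monom_def charge_single add.nat_pow_eone)

lemma charge_ybar_monom: "\<alpha> \<in> carrier F \<Longrightarrow> charge (ybar_monom i \<alpha>) j = (if i = j then \<ominus> \<alpha> else \<zero>)"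
  by (simp add: ybar_monom_def charge_single add.nat_pow_eone)

fun monom_times :: "nat \<Rightarrow> 'a cmonom \<Rightarrow> 'a cmonom" where
  "monom_times 0 m = 0"
| "monom_times (Suc k) m = m + monom_times k m"

lemma single_power: "Poly_Mapping.single m (1::complex) ^ k = Poly_Mapping.single (monom_times k m) 1"
  for m :: "'a cmonom"
  by (induction k) (auto simp: mult_single)

lemma labelled_monom_times: "labelled m \<Longrightarrow> labelled (monom_times k m)"
  by (induction k) (auto simp: labelled_add, simp add: labelled_def)

lemma charge_monom_times: "labelled m \<Longrightarrow> charge (monom_times k m) i = [k] \<cdot> charge m i"
  by (induction k)
     (simp_all add: add.nat_pow_0 charge_add labelled_monom_times charge_closed add.nat_pow_Suc a_comm)

text \<open>Applied to \<open>u = \<beta> v\<close> on the support of \<open>v\<close>, it gives the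
  constraint monomial the charge \<open>\<beta> v\<close>. A zero label contributes the monomial 0,
  in accordance with the convention for \<open>y_poly\<close>.\<close>

lemma prod_y_poly:
  assumes "finite A" "\<And>i. i \<in> A \<Longrightarrow> u i \<in> carrier F"
  shows "\<exists>M. (\<Prod>i\<in>A. y_poly F i (u i)) = Poly_Mapping.single M 1 \<and> labelled M \<and>
    (\<forall>j. charge M j = (if j \<in> A then u j else \<zero>))"
  using assms
proof (induction A rule: finite_induct)
  case empty
  show ?case by (rule exI[of _ 0]) (simp add: labelled_def)
next
  case (insert a A)
  then obtain M where M: "(\<Prod>i\<in>A. y_poly F i (u i)) = Poly_Mapping.single M 1" "labelled M"
    "\<forall>j. charge M j = (if j \<in> A then u j else \<zero>)" by auto
  show ?case
  proof (intro exI conjI allI)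
    show "(\<Prod>i\<in>insert a A. y_poly F i (u i)) = Poly_Mapping.single (y_monom a (u a) + M) 1"
      using insert M by (simp add: y_poly_eq mult_single)
    show "labelled (y_monom a (u a) + M)"
      using insert M by (intro labelled_add labelled_y_monom) auto
    show "charge (y_monom a (u a) + M) j = (if j \<in> insert a A then u j else \<zero>)" for j
      using insert M by (auto simp: charge_add labelled_y_monom charge_y_monom)
  qed
qed

end

subsection \<open>The pseudo-expectation of an expanding instance\<close>

context finite_field
begin

definition combination :: "(nat \<Rightarrow> 'a) set \<Rightarrow> ((nat \<Rightarrow> 'a) \<Rightarrow> 'a) \<Rightarrow> nat \<Rightarrow> 'a" where
  "combination H \<gamma> i = (\<Oplus>v\<in>H. \<gamma> v \<otimes> v i)"

definition combination_size :: "(nat \<Rightarrow> 'a) set \<Rightarrow> ((nat \<Rightarrow> 'a) \<Rightarrow> 'a) \<Rightarrow> nat" where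
  "combination_size H \<gamma> = card {v\<in>H. \<gamma> v \<noteq> \<zero>}"

end

text \<open>\<open>independent\<close> makes the right-hand side of a derived vector unique.
  \<open>wide\<close> is the gap: a combination of at most \<open>2s\<close> equations and weight at
  most \<open>2 * (d div 2)\<close> has fewer than \<open>s\<close> equations. The number
  \<open>2 * (d div 2)\<close> bounds the weight of a difference of two charges of monomials in an
  \<open>f\<close> with \<open>2 * var_degree f \<le> d\<close>.\<close>

locale expanding_klin = finite_field F for F :: "'a ring" (structure) +
  fixes n s d :: nat and H :: "(nat \<Rightarrow> 'a) set" and b :: "(nat \<Rightarrow> 'a) \<Rightarrow> 'a"
  assumes finite_H: "finite H"
    and H_carrier: "\<And>v i. v \<in> H \<Longrightarrow> v i \<in> carrier F \<or> n \<le> i"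
    and b_carrier: "\<And>v. v \<in> H \<Longrightarrow> b v \<in> carrier F"
    and two_le_s: "2 \<le> s"
    and independent: "\<And>\<gamma>. \<gamma> \<in> H \<rightarrow> carrier F \<Longrightarrow> 1 \<le> combination_size H \<gamma> \<Longrightarrow>
      combination_size H \<gamma> \<le> 2 * s \<Longrightarrow> supp F n (combination H \<gamma>) \<noteq> {}"
    and wide: "\<And>\<gamma>. \<gamma> \<in> H \<rightarrow> carrier F \<Longrightarrow> s \<le> combination_size H \<gamma> \<Longrightarrow>
      combination_size H \<gamma> \<le> 2 * s \<Longrightarrow> 2 * (d div 2) < card (supp F n (combination H \<gamma>))"
begin

section \<open>Right-hand sides and phases of derived vectors\<close>

definition rhs :: "((nat \<Rightarrow> 'a) \<Rightarrow> 'a) \<Rightarrow> 'a" where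
  "rhs \<gamma> = (\<Oplus>v\<in>H. \<gamma> v \<otimes> b v)"

definition derives :: "((nat \<Rightarrow> 'a) \<Rightarrow> 'a) \<Rightarrow> (nat \<Rightarrow> 'a) \<Rightarrow> bool" where
  "derives \<gamma> u \<longleftrightarrow> \<gamma> \<in> H \<rightarrow> carrier F \<and> combination_size H \<gamma> < s \<and>
     (\<forall>i<n. combination H \<gamma> i = u i)"

text \<open>The derivation picked by \<open>SOME\<close> does not influence the value, by
  \<open>rhs_unique\<close>.\<close>

definition phase :: "(nat \<Rightarrow> 'a) \<Rightarrow> complex" where
  "phase u = (if \<exists>\<gamma>. derives \<gamma> u then trace_character (rhs (SOME \<gamma>. derives \<gamma> u)) else 0)"

lemma H_closed: "v \<in> H \<Longrightarrow> i < n \<Longrightarrow> v i \<in> carrier F"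
  using H_carrier[of v i] by auto

lemma combination_closed:
  "\<gamma> \<in> H \<rightarrow> carrier F \<Longrightarrow> i < n \<Longrightarrow> combination H \<gamma> i \<in> carrier F"
  unfolding combination_def by (intro finsum_closed) (auto simp: H_closed)

lemma rhs_closed: "\<gamma> \<in> H \<rightarrow> carrier F \<Longrightarrow> rhs \<gamma> \<in> carrier F"
  unfolding rhs_def by (intro finsum_closed) (auto simp: b_carrier)

lemma finsum_add_left:
  assumes "\<gamma> \<in> H \<rightarrow> carrier F" "\<delta> \<in> H \<rightarrow> carrier F" "f \<in> H \<rightarrow> carrier F"
  shows "(\<Oplus>v\<in>H. (\<gamma> v \<oplus> \<delta> v) \<otimes> f v) = (\<Oplus>v\<in>H. \<gamma> v \<otimes> f v) \<oplus> (\<Oplus>v\<in>H. \<delta> v \<otimes> f v)"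
proof -
  have "(\<Oplus>v\<in>H. (\<gamma> v \<oplus> \<delta> v) \<otimes> f v) = (\<Oplus>v\<in>H. \<gamma> v \<otimes> f v \<oplus> \<delta> v \<otimes> f v)"
    using assms by (intro finsum_cong') (auto simp: Pi_iff l_distr)
  then show ?thesis using assms by (simp add: finsum_addf Pi_iff)
qed

lemma finsum_minus_left:
  assumes "\<gamma> \<in> H \<rightarrow> carrier F" "f \<in> H \<rightarrow> carrier F"
  shows "(\<Oplus>v\<in>H. (\<ominus> \<gamma> v) \<otimes> f v) = \<ominus> (\<Oplus>v\<in>H. \<gamma> v \<otimes> f v)"
proof -
  have "(\<Oplus>v\<in>H. (\<ominus> \<gamma> v) \<otimes> f v) \<oplus> (\<Oplus>v\<in>H. \<gamma> v \<otimes> f v) =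
      (\<Oplus>v\<in>H. (\<ominus> \<gamma> v \<oplus> \<gamma> v) \<otimes> f v)"
    using assms by (intro finsum_add_left[symmetric]) auto
  also have "\<dots> = (\<Oplus>v\<in>H. \<zero>)"
    using assms by (intro finsum_cong') (auto simp: Pi_iff l_neg)
  also have "\<dots> = \<zero>" by simp
  finally show ?thesis
    using assms by (intro minus_equality[symmetric] finsum_closed) auto
qed

lemma combination_add:
  "\<gamma> \<in> H \<rightarrow> carrier F \<Longrightarrow> \<delta> \<in> H \<rightarrow> carrier F \<Longrightarrow> i < n \<Longrightarrow>
    combination H (\<lambda>v. \<gamma> v \<oplus> \<delta> v) i = combination H \<gamma> i \<oplus> combination H \<delta> i"
  unfolding combination_def by (intro finsum_add_left) (auto simp: H_closed)

lemma combination_minus: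
  "\<gamma> \<in> H \<rightarrow> carrier F \<Longrightarrow> i < n \<Longrightarrow>
    combination H (\<lambda>v. \<ominus> \<gamma> v) i = \<ominus> combination H \<gamma> i"
  unfolding combination_def by (intro finsum_minus_left) (auto simp: H_closed)

lemma rhs_add:
  "\<gamma> \<in> H \<rightarrow> carrier F \<Longrightarrow> \<delta> \<in> H \<rightarrow> carrier F \<Longrightarrow> rhs (\<lambda>v. \<gamma> v \<oplus> \<delta> v) = rhs \<gamma> \<oplus> rhs \<delta>"
  unfolding rhs_def by (intro finsum_add_left) (auto simp: b_carrier)

lemma rhs_minus: "\<gamma> \<in> H \<rightarrow> carrier F \<Longrightarrow> rhs (\<lambda>v. \<ominus> \<gamma> v) = \<ominus> rhs \<gamma>"
  unfolding rhs_def by (intro finsum_minus_left) (auto simp: b_carrier)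

lemma combination_size_add:
  "combination_size H (\<lambda>v. \<gamma> v \<oplus> \<delta> v) \<le> combination_size H \<gamma> + combination_size H \<delta>"
proof -
  have "card {v\<in>H. \<gamma> v \<oplus> \<delta> v \<noteq> \<zero>} \<le> card ({v\<in>H. \<gamma> v \<noteq> \<zero>} \<union> {v\<in>H. \<delta> v \<noteq> \<zero>})"
    using finite_H by (intro card_mono) auto
  also have "\<dots> \<le> card {v\<in>H. \<gamma> v \<noteq> \<zero>} + card {v\<in>H. \<delta> v \<noteq> \<zero>}"
    by (rule card_Un_le)
  finally show ?thesis by (simp add: combination_size_def)
qed

lemma combination_size_minus:
  assumes "\<gamma> \<in> H \<rightarrow> carrier F"
  shows "combination_size H (\<lambda>v. \<ominus> \<gamma> v) = combination_size H \<gamma>"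
proof -
  have "\<ominus> \<gamma> v \<noteq> \<zero> \<longleftrightarrow> \<gamma> v \<noteq> \<zero>" if "v \<in> H" for v
    using assms that by (metis PiE a_inv_closed minus_minus minus_zero)
  then show ?thesis unfolding combination_size_def by (metis (no_types, lifting) Collect_cong)
qed

text \<open>The difference of two derivations has at most \<open>2s\<close> equations and vanishes
  on all sites, so \<open>independent\<close> forces every coefficient to be zero. The vectors need
  to agree only below \<open>n\<close>, where they carry meaning.\<close>

lemma rhs_unique:
  assumes "derives \<gamma> u" "derives \<delta> u'" "\<And>i. i < n \<Longrightarrow> u i = u' i"
  shows "rhs \<gamma> = rhs \<delta>"
proof -
  have g: "\<gamma> \<in> H \<rightarrow> carrier F" and d: "\<delta> \<in> H \<rightarrow> carrier F" and d': "(\<lambda>v. \<ominus> \<delta> v) \<in> H \<rightarrow> carrier F"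
    using assms by (auto simp: derives_def)
  define \<eta> where "\<eta> = (\<lambda>v. \<gamma> v \<oplus> \<ominus> \<delta> v)"
  have e: "\<eta> \<in> H \<rightarrow> carrier F" using g d by (fastforce simp: \<eta>_def)
  have "combination H \<eta> i = \<zero>" if "i < n" for i
    using combination_add[OF g d' that] combination_minus[OF d that] assms that
      combination_closed[OF d that] combination_closed[OF g that]
    by (simp add: derives_def r_neg \<eta>_def)
  then have "supp F n (combination H \<eta>) = {}" by (auto simp: supp_def)
  moreover have "combination_size H \<eta> \<le> 2 * s"
    using combination_size_add[of \<gamma> "\<lambda>v. \<ominus> \<delta> v"] combination_size_minus[OF d] assms
    by (simp add: derives_def \<eta>_def)
  ultimately have "combination_size H \<eta> = 0"
    using independent[OF e] by force
  then have z: "\<eta> v = \<zero>" if "v \<in> H" for v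
    using finite_H that by (auto simp: combination_size_def)
  have "rhs \<eta> = (\<Oplus>v\<in>H. \<zero>)"
    unfolding rhs_def using z b_carrier by (intro finsum_cong') auto
  then have "rhs \<gamma> \<oplus> \<ominus> rhs \<delta> = \<zero>"
    using rhs_add[OF g d'] rhs_minus[OF d] by (simp add: \<eta>_def)
  then show ?thesis
    using rhs_closed[OF g] rhs_closed[OF d] by (metis r_right_minus_eq minus_eq)
qed

lemma phase_eq:
  assumes "derives \<gamma> u"
  shows "phase u = trace_character (rhs \<gamma>)"
proof -
  have "derives (SOME \<gamma>. derives \<gamma> u) u" using assms by (rule someI[of "\<lambda>\<gamma>. derives \<gamma> u"])
  then have "rhs (SOME \<gamma>. derives \<gamma> u) = rhs \<gamma>" using assms by (rule rhs_unique) simp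
  then show ?thesis using assms by (auto simp: phase_def)
qed

lemma phase_nonzero_derives: "phase u \<noteq> 0 \<Longrightarrow> \<exists>\<gamma>. derives \<gamma> u"
  by (auto simp: phase_def split: if_splits)

lemma derives_cong:
  assumes "\<And>i. i < n \<Longrightarrow> u i = u' i"
  shows "derives \<gamma> u \<longleftrightarrow> derives \<gamma> u'"
  using assms by (auto simp: derives_def)

lemma phase_cong:
  assumes "\<And>i. i < n \<Longrightarrow> u i = u' i"
  shows "phase u = phase u'"
  using derives_cong[OF assms] by (simp add: phase_def)

lemma derives_zero: "derives (\<lambda>v. \<zero>) (\<lambda>i. \<zero>)"
proof -
  have "combination H (\<lambda>v. \<zero>) i = \<zero>" if "i < n" for i
  proof -
    have "combination H (\<lambda>v. \<zero>) i = (\<Oplus>v\<in>H. \<zero>)"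
      unfolding combination_def using that by (intro finsum_cong') (auto simp: H_closed)
    then show ?thesis by simp
  qed
  then show ?thesis using two_le_s by (simp add: derives_def combination_size_def)
qed

lemma rhs_zero: "rhs (\<lambda>v. \<zero>) = \<zero>"
proof -
  have "rhs (\<lambda>v. \<zero>) = (\<Oplus>v\<in>H. \<zero>)"
    unfolding rhs_def by (intro finsum_cong') (auto simp: b_carrier)
  then show ?thesis by simp
qed

lemma phase_zero:
  assumes "\<And>i. i < n \<Longrightarrow> u i = \<zero>"
  shows "phase u = 1"
proof -
  have "derives (\<lambda>v. \<zero>) u"
    using derives_zero derives_cong[of u "\<lambda>i. \<zero>"] assms by simp
  then show ?thesis by (simp add: phase_eq rhs_zero trace_character_zero)
qed

lemma derives_minus:
  assumes "derives \<gamma> u"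
  shows "derives (\<lambda>v. \<ominus> \<gamma> v) (\<lambda>i. \<ominus> u i)"
  using assms by (auto simp: derives_def combination_size_minus combination_minus)

lemma phase_minus:
  assumes "\<And>i. i < n \<Longrightarrow> u i \<in> carrier F"
  shows "phase (\<lambda>i. \<ominus> u i) = cnj (phase u)"
proof (cases "\<exists>\<gamma>. derives \<gamma> u")
  case True
  then obtain \<gamma> where g: "derives \<gamma> u" by auto
  then have "\<gamma> \<in> H \<rightarrow> carrier F" by (simp add: derives_def)
  then show ?thesis
    using phase_eq[OF g] phase_eq[OF derives_minus[OF g]]
    by (simp add: rhs_minus trace_character_minus rhs_closed)
next
  case False
  \<comment> \<open>A derivation of the negated vector could be negated once more to give one of
    \<open>u\<close>.\<close>
  have "\<not> derives \<gamma> (\<lambda>i. \<ominus> u i)" for \<gamma>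
    using derives_minus[of \<gamma> "\<lambda>i. \<ominus> u i"] False derives_cong[of "\<lambda>i. \<ominus> (\<ominus> u i)" u] assms by auto
  then show ?thesis using False by (simp add: phase_def)
qed

text \<open>Adding the derivations may leave the range of fewer than \<open>s\<close> equations; low
  weight of the sum together with \<open>wide\<close> brings it back. Without the weight bound the
  phase could jump to 0 and positivity would break.\<close>

lemma phase_add:
  assumes "derives \<gamma> u" "derives \<delta> u'"
    and small: "card (supp F n (\<lambda>i. u i \<oplus> u' i)) \<le> 2 * (d div 2)"
  shows "phase (\<lambda>i. u i \<oplus> u' i) = phase u * phase u'"
proof -
  have g: "\<gamma> \<in> H \<rightarrow> carrier F" and d: "\<delta> \<in> H \<rightarrow> carrier F"
    using assms by (auto simp: derives_def)
  let ?\<eta> = "\<lambda>v. \<gamma> v \<oplus> \<delta> v"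
  have e: "?\<eta> \<in> H \<rightarrow> carrier F" using g d by auto
  have comb: "combination H ?\<eta> i = u i \<oplus> u' i" if "i < n" for i
    using combination_add[OF g d that] assms that by (simp add: derives_def)
  have supp: "supp F n (combination H ?\<eta>) = supp F n (\<lambda>i. u i \<oplus> u' i)"
    using comb by (auto simp: supp_def)
  have "combination_size H ?\<eta> \<le> 2 * s"
    using combination_size_add[of \<gamma> \<delta>] assms by (simp add: derives_def)
  then have "combination_size H ?\<eta> < s"
    using wide[OF e] small supp by force
  then have "derives ?\<eta> (\<lambda>i. u i \<oplus> u' i)"
    using e comb by (simp add: derives_def)
  then show ?thesis
    using phase_eq assms by (simp add: rhs_add g d trace_character_add rhs_closed)
qed

section \<open>The functional and its axioms\<close>

definition pseudo :: "'a cpoly \<Rightarrow> complex" where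
  "pseudo = linear_ext (\<lambda>m. phase (charge m))"

text \<open>Both families of ideal constraints are differences of two monomials of equal charge, and
  the functional sees a monomial only through its charge. The constraints therefore hold after
  multiplication by any \<open>f\<close>.\<close>

lemma pseudo_mult_diff:
  assumes f: "f \<in> cpolys F n" and M: "labelled M" "labelled M'" "\<And>i. i < n \<Longrightarrow> charge M i = charge M' i"
  shows "pseudo (f * (Poly_Mapping.single M 1 - Poly_Mapping.single M' 1)) = 0"
proof -
  have "phase (charge (m + M)) = phase (charge (m + M'))" if "m \<in> Poly_Mapping.keys f" for m
    using cpolys_labelled[OF f that] M by (intro phase_cong) (simp add: charge_add)
  then show ?thesis
    by (simp add: pseudo_def right_diff_distrib linear_ext_minus linear_ext_mult_single)
qed

text \<open>The kernel is the phase of a difference of charges. It is multiplicative because charge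
  \<open>m1 - m3\<close> is the sum of \<open>m1 - m2\<close> and \<open>m2 - m3\<close>, and the
  degree bound on \<open>f\<close> keeps this sum light enough for \<open>phase_add\<close>.\<close>

lemma pseudo_square_nonneg:
  assumes f: "f \<in> cpolys F n" and deg: "2 * var_degree f \<le> d"
  shows "pseudo (f * conj_poly f) \<in> \<real>\<^sub>\<ge>\<^sub>0"
proof -
  let ?K = "\<lambda>m m'. phase (charge (m + conj_monom m'))"
  note lab = cpolys_labelled[OF f]
  have K: "?K m m' = phase (\<lambda>i. charge m i \<oplus> \<ominus> charge m' i)"
    if "m \<in> Poly_Mapping.keys f" "m' \<in> Poly_Mapping.keys f" for m m'
    using lab that by (intro phase_cong) (simp add: charge_add labelled_conj charge_conj)
  have small: "card (supp F n (\<lambda>i. charge m i \<oplus> \<ominus> charge m' i)) \<le> 2 * (d div 2)"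
    if m: "m \<in> Poly_Mapping.keys f" "m' \<in> Poly_Mapping.keys f" for m m'
  proof -
    have deg_le: "card (supp F n (charge m)) \<le> d div 2" if "m \<in> Poly_Mapping.keys f" for m
    proof -
      have "monom_var_degree m \<le> var_degree f"
        unfolding var_degree_def using that by (intro Max_ge) auto
      then show ?thesis using card_supp_charge[of n m] deg by linarith
    qed
    have "supp F n (\<lambda>i. charge m i \<oplus> \<ominus> charge m' i) \<subseteq> supp F n (charge m) \<union> supp F n (charge m')"
      by (auto simp: supp_def)
    then have "card (supp F n (\<lambda>i. charge m i \<oplus> \<ominus> charge m' i)) \<le>
        card (supp F n (charge m) \<union> supp F n (charge m'))"
      by (intro card_mono) (auto simp: supp_def)
    also have "\<dots> \<le> card (supp F n (charge m)) + card (supp F n (charge m'))"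
      by (rule card_Un_le)
    finally show ?thesis using deg_le[OF m(1)] deg_le[OF m(2)] by linarith
  qed
  have "(\<Sum>m\<in>Poly_Mapping.keys f. \<Sum>m'\<in>Poly_Mapping.keys f.
      Poly_Mapping.lookup f m * cnj (Poly_Mapping.lookup f m') * ?K m m') \<in> \<real>\<^sub>\<ge>\<^sub>0"
  proof (rule multiplicative_kernel_nonneg)
    fix m1 assume m1: "m1 \<in> Poly_Mapping.keys f"
    have c1: "charge m1 i \<in> carrier F" for i using charge_closed lab m1 by blast
    show "?K m1 m1 = 1"
      unfolding K[OF m1 m1] using c1 by (intro phase_zero) (simp add: r_neg)
    fix m2 assume m2: "m2 \<in> Poly_Mapping.keys f"
    have c2: "charge m2 i \<in> carrier F" for i using charge_closed lab m2 by blast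
    have "?K m2 m1 = phase (\<lambda>i. \<ominus> (charge m1 i \<oplus> \<ominus> charge m2 i))"
      unfolding K[OF m2 m1] using c1 c2 by (intro phase_cong) (simp add: minus_add a_comm)
    also have "\<dots> = cnj (?K m1 m2)"
      unfolding K[OF m1 m2] using c1 c2 by (intro phase_minus) auto
    finally show "?K m2 m1 = cnj (?K m1 m2)" .
    fix m3 assume m3: "m3 \<in> Poly_Mapping.keys f"
    have c3: "charge m3 i \<in> carrier F" for i using charge_closed lab m3 by blast
    assume nz: "?K m1 m2 \<noteq> 0" "?K m2 m3 \<noteq> 0"
    obtain \<gamma> where g: "derives \<gamma> (\<lambda>i. charge m1 i \<oplus> \<ominus> charge m2 i)"
      using nz(1) phase_nonzero_derives unfolding K[OF m1 m2] by blast
    obtain \<delta> where d: "derives \<delta> (\<lambda>i. charge m2 i \<oplus> \<ominus> charge m3 i)"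
      using nz(2) phase_nonzero_derives unfolding K[OF m2 m3] by blast
    have eq: "charge m1 i \<oplus> \<ominus> charge m2 i \<oplus> (charge m2 i \<oplus> \<ominus> charge m3 i) =
        charge m1 i \<oplus> \<ominus> charge m3 i" for i
      using c1[of i] c2[of i] c3[of i] by (simp add: a_assoc r_neg1)
    show "?K m1 m3 = ?K m1 m2 * ?K m2 m3"
      unfolding K[OF m1 m3] K[OF m1 m2] K[OF m2 m3]
      using phase_add[OF g d] small[OF m1 m3] by (simp only: eq)
  qed simp
  then show ?thesis by (simp add: pseudo_def linear_ext_mult_conj)
qed

lemma pseudo_one: "pseudo 1 = 1"
  unfolding pseudo_def by (simp add: linear_ext_def phase_zero)

lemma pseudo_expectation: "complex_pseudo_expectation F n d pseudo"
proof -
  have root: "pseudo (f * (y_poly F i \<alpha> ^ p - 1)) = 0"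
    if "\<alpha> \<in> carrier F" "f \<in> cpolys F n" for i \<alpha> f
  proof -
    have "charge (monom_times p (y_monom i \<alpha>)) j = charge 0 j" for j
      using that by (simp add: charge_monom_times labelled_y_monom charge_y_monom char_times_eq_zero)
    then show ?thesis
      using pseudo_mult_diff[of f "monom_times p (y_monom i \<alpha>)" 0] that
      by (simp add: y_poly_eq single_power labelled_monom_times labelled_y_monom)
         (simp add: labelled_def)
  qed
  have quot: "pseudo (f * (y_poly F i \<alpha> * ybar_poly F i \<beta> - y_poly F i (\<alpha> \<ominus> \<beta>))) = 0"
    if "\<alpha> \<in> carrier F" "\<beta> \<in> carrier F" "f \<in> cpolys F n" for i \<alpha> \<beta> f
  proof -
    have "charge (y_monom i \<alpha> + ybar_monom i \<beta>) j = charge (y_monom i (\<alpha> \<ominus> \<beta>)) j" for j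
      using that
      by (simp add: charge_add labelled_y_monom labelled_ybar_monom charge_y_monom charge_ybar_monom minus_eq)
    then show ?thesis
      using pseudo_mult_diff[of f "y_monom i \<alpha> + ybar_monom i \<beta>" "y_monom i (\<alpha> \<ominus> \<beta>)"] that
      by (simp add: y_poly_eq ybar_poly_eq mult_single labelled_add labelled_y_monom labelled_ybar_monom)
  qed
  show ?thesis
    unfolding complex_pseudo_expectation_def
    using root quot pseudo_square_nonneg pseudo_one
    by (auto simp: pseudo_def linear_ext_add linear_ext_const_mult)
qed

lemma pseudo_satisfies: "satisfies_klin F n pseudo (H, b)"
  unfolding satisfies_klin_def prod.case
proof (intro ballI)
  fix v \<beta> assume v: "v \<in> H" and \<beta>: "\<beta> \<in> carrier F - {\<zero>}"
  obtain M where M: "(\<Prod>i\<in>supp F n v. y_poly F i (\<beta> \<otimes> v i)) = Poly_Mapping.single M 1"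
    "\<And>j. charge M j = (if j \<in> supp F n v then \<beta> \<otimes> v j else \<zero>)"
    using prod_y_poly[of "supp F n v" "\<lambda>i. \<beta> \<otimes> v i"] v \<beta> H_closed by (auto simp: supp_def)
  let ?\<gamma> = "\<lambda>w. if w = v then \<beta> else \<zero>"
  have single: "(\<Oplus>w\<in>H. ?\<gamma> w \<otimes> f w) = \<beta> \<otimes> f v" if "f \<in> H \<rightarrow> carrier F" for f
  proof -
    have "(\<Oplus>w\<in>H. ?\<gamma> w \<otimes> f w) = (\<Oplus>w\<in>{v}. \<beta> \<otimes> f w)"
      using that v \<beta> finite_H by (intro add.finprod_mono_neutral_cong_right) (auto simp: Pi_iff)
    moreover have "f v \<in> carrier F" using that v by auto
    ultimately show ?thesis using \<beta> by (simp add: finsum_insert)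
  qed
  have "{w \<in> H. ?\<gamma> w \<noteq> \<zero>} = {v}" using v \<beta> by auto
  \<comment> \<open>A single equation is a combination of size 1, which is below \<open>s\<close> by
    \<open>two_le_s\<close>.\<close>
  then have "derives ?\<gamma> (charge M)"
    using v \<beta> two_le_s single H_closed
    by (auto simp: derives_def combination_size_def combination_def M(2) supp_def)
  then have "phase (charge M) = trace_character (\<beta> \<otimes> b v)"
    using phase_eq single[of b] b_carrier by (simp add: rhs_def)
  then show "pseudo (\<Prod>i\<in>supp F n v. y_poly F i (\<beta> \<otimes> v i)) = omega p ^ trace_rep F (\<beta> \<otimes> b v)"
    by (simp add: M(1) pseudo_def linear_ext_single trace_character_def)
qed

end

subsection \<open>Counting low-weight combinations of sparse vectors\<close>

text \<open>Free of division, this says that a random \<open>m\<close>-subset of \<open>M\<close>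
  points contains \<open>s\<close> given points with probability at most \<open>(m/M)^s\<close>: the
  probability is the product of the fractions \<open>(m-i)/(M-i)\<close>, each at most
  \<open>m/M\<close>.\<close>

lemma binomial_superset_bound:
  assumes "s \<le> m" "m \<le> M"
  shows "((M - s) choose (m - s)) * M ^ s \<le> (M choose m) * m ^ s"
  using assms(1)
proof (induction s)
  case (Suc s)
  have le: "m - s \<le> M - s" using assms(2) by simp
  have "(m - s) * ((M - s) choose (m - s)) = (M - s) * ((M - s - 1) choose (m - s - 1))"
    using Suc.prems by (intro times_binomial_minus1_eq) auto
  then have rec: "(M - s) * ((M - Suc s) choose (m - Suc s)) = (m - s) * ((M - s) choose (m - s))"
    by (metis diff_Suc_eq_diff_pred diff_commute One_nat_def)
  have frac: "(m - s) * M \<le> m * (M - s)"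
  proof -
    have "m * s \<le> s * M" using assms(2) by simp
    then show ?thesis by (simp add: diff_mult_distrib diff_mult_distrib2 diff_le_mono2)
  qed
  have "(M - s) * (((M - Suc s) choose (m - Suc s)) * M ^ Suc s) =
      ((M - s) choose (m - s)) * M ^ s * ((m - s) * M)"
  proof -
    have "(M - s) * (((M - Suc s) choose (m - Suc s)) * M ^ Suc s) =
        ((M - s) * ((M - Suc s) choose (m - Suc s))) * M ^ Suc s" by (simp only: mult.assoc)
    then show ?thesis unfolding rec by (simp add: mult_ac)
  qed
  also have "\<dots> \<le> ((M choose m) * m ^ s) * (m * (M - s))"
    by (rule mult_le_mono) (use Suc frac in auto)
  also have "\<dots> = (M - s) * ((M choose m) * m ^ Suc s)" by simp
  finally show ?case using Suc.prems assms(2) by simp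
qed simp

lemma card_supersets_of_size:
  assumes "finite V" "S \<subseteq> V" "card S \<le> m"
  shows "card {H. H \<subseteq> V \<and> card H = m \<and> S \<subseteq> H} = (card V - card S) choose (m - card S)"
proof -
  have fS: "finite S" using assms finite_subset by auto
  have "bij_betw (\<lambda>T. T \<union> S) {T. T \<subseteq> V - S \<and> card T = m - card S} {H. H \<subseteq> V \<and> card H = m \<and> S \<subseteq> H}"
  proof (rule bij_betw_byWitness[where f' = "\<lambda>H. H - S"])
    show "(\<lambda>T. T \<union> S) ` {T. T \<subseteq> V - S \<and> card T = m - card S} \<subseteq> {H. H \<subseteq> V \<and> card H = m \<and> S \<subseteq> H}"
    proof safe
      fix T assume T: "T \<subseteq> V - S" "card T = m - card S"
      have "finite T" using T(1) assms(1) by (meson finite_Diff finite_subset)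
      then have "card (T \<union> S) = card T + card S"
        using T(1) fS by (intro card_Un_disjoint) auto
      then show "card (T \<union> S) = m" using T assms by simp
    qed (use assms in auto)
    show "(\<lambda>H. H - S) ` {H. H \<subseteq> V \<and> card H = m \<and> S \<subseteq> H} \<subseteq> {T. T \<subseteq> V - S \<and> card T = m - card S}"
      using fS by (auto simp: card_Diff_subset)
  qed auto
  then have "card {H. H \<subseteq> V \<and> card H = m \<and> S \<subseteq> H} = card {T. T \<subseteq> V - S \<and> card T = m - card S}"
    by (simp add: bij_betw_same_card)
  also have "\<dots> = card (V - S) choose (m - card S)"
    using assms by (intro n_subsets) auto
  also have "card (V - S) = card V - card S"
    using assms fS by (intro card_Diff_subset) auto
  finally show ?thesis .
qed

text \<open>Union bound over \<open>B\<close>, with the denominators cleared. For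
  \<open>s > m\<close> no set of size \<open>m\<close> contains a member of
  \<open>B\<close>.\<close>

lemma card_containing_family_bound:
  assumes V: "finite V" and B: "\<And>S. S \<in> B \<Longrightarrow> S \<subseteq> V \<and> card S = s" and m: "m \<le> card V"
  shows "real (card {H. H \<subseteq> V \<and> card H = m \<and> (\<exists>S\<in>B. S \<subseteq> H)}) * real (card V) ^ s
    \<le> real (card B) * real (card V choose m) * real m ^ s"
proof (cases "s \<le> m")
  case False
  have "\<not> S \<subseteq> H" if "H \<subseteq> V" "card H = m" "S \<in> B" for H S
  proof
    assume "S \<subseteq> H"
    then have "card S \<le> card H" using finite_subset[OF that(1) V] by (rule card_mono[rotated])
    then show False using that False B[OF that(3)] by simp
  qed
  then have "{H. H \<subseteq> V \<and> card H = m \<and> (\<exists>S\<in>B. S \<subseteq> H)} = {}" by auto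
  then show ?thesis by (simp only: card.empty) simp
next
  case True
  have finB: "finite B" by (rule finite_subset[of _ "Pow V"]) (use B V in auto)
  have "{H. H \<subseteq> V \<and> card H = m \<and> (\<exists>S\<in>B. S \<subseteq> H)} = (\<Union>S\<in>B. {H. H \<subseteq> V \<and> card H = m \<and> S \<subseteq> H})"
    by auto
  then have "card {H. H \<subseteq> V \<and> card H = m \<and> (\<exists>S\<in>B. S \<subseteq> H)}
      \<le> (\<Sum>S\<in>B. card {H. H \<subseteq> V \<and> card H = m \<and> S \<subseteq> H})"
    using card_UN_le[OF finB] by simp
  also have "\<dots> = card B * ((card V - s) choose (m - s))"
    using B True by (simp add: card_supersets_of_size[OF V])
  finally have "card {H. H \<subseteq> V \<and> card H = m \<and> (\<exists>S\<in>B. S \<subseteq> H)} * card V ^ s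
      \<le> card B * ((card V - s) choose (m - s)) * card V ^ s"
    by (rule mult_le_mono1)
  also have "\<dots> = card B * (((card V - s) choose (m - s)) * card V ^ s)" by (rule mult.assoc)
  also have "\<dots> \<le> card B * ((card V choose m) * m ^ s)"
    using binomial_superset_bound[OF True m] by (intro mult_le_mono2)
  finally have "real (card {H. H \<subseteq> V \<and> card H = m \<and> (\<exists>S\<in>B. S \<subseteq> H)} * card V ^ s)
      \<le> real (card B * ((card V choose m) * m ^ s))"
    by (simp only: of_nat_le_iff)
  then show ?thesis by (simp add: mult.assoc)
qed

section \<open>The potential of walks with single-coordinate steps\<close>

context finite_field
begin

abbreviation "units_card \<equiv> card (carrier F - {\<zero>})"
abbreviation "weight n w \<equiv> card (supp F n w)"

definition vec_add :: "(nat \<Rightarrow> 'a) \<Rightarrow> (nat \<Rightarrow> 'a) \<Rightarrow> nat \<Rightarrow> 'a" where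
  "vec_add w u i = w i \<oplus> u i"

definition is_vec :: "nat \<Rightarrow> (nat \<Rightarrow> 'a) \<Rightarrow> bool" where
  "is_vec n w \<longleftrightarrow> (\<forall>i<n. w i \<in> carrier F)"

lemma finite_supp [simp]: "finite (supp F n w)"
  by (simp add: supp_def)

lemma supp_cong: "(\<And>i. i < n \<Longrightarrow> u i = w i) \<Longrightarrow> supp F n u = supp F n w"
  by (auto simp: supp_def)

lemma supp_upd:
  "i < n \<Longrightarrow> supp F n (w(i := c)) = (if c = \<zero> then supp F n w - {i} else insert i (supp F n w))"
  by (auto simp: supp_def)

lemma weight_vec_add_le:
  "weight n (vec_add w u) \<le> weight n w + weight n u"
proof -
  have "weight n (vec_add w u) \<le> card (supp F n w \<union> supp F n u)"
    by (intro card_mono) (auto simp: supp_def vec_add_def)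
  also have "\<dots> \<le> weight n w + weight n u" by (rule card_Un_le)
  finally show ?thesis .
qed

text \<open>On the support one value of \<open>a\<close> cancels the coordinate and divides the
  potential by \<open>\<theta>\<close>, while all others keep the weight. Off the support every
  \<open>a\<close> raises the weight by one.\<close>

lemma sum_coordinate_step:
  fixes \<theta> :: real
  assumes w: "is_vec n w" and \<theta>: "0 < \<theta>" and i: "i < n"
  shows "(\<Sum>a\<in>carrier F - {\<zero>}. \<theta> ^ weight n (w(i := w i \<oplus> a))) \<le>
    \<theta> ^ weight n w * (if i \<in> supp F n w then 1 / \<theta> + units_card else units_card * \<theta>)"
proof (cases "i \<in> supp F n w")
  case False
  then have "w i = \<zero>" using i by (auto simp: supp_def)
  then have "\<theta> ^ weight n (w(i := w i \<oplus> a)) = \<theta> ^ weight n w * \<theta>" if "a \<in> carrier F - {\<zero>}" for a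
    using that i False by (simp add: supp_upd)
  then have "(\<Sum>a\<in>carrier F - {\<zero>}. \<theta> ^ weight n (w(i := w i \<oplus> a))) = (\<Sum>a\<in>carrier F - {\<zero>}. \<theta> ^ weight n w * \<theta>)"
    by (intro sum.cong) auto
  then show ?thesis using False by simp
next
  case True
  let ?A = "carrier F - {\<zero>}"
  have pos: "weight n w > 0" using True by (auto simp: card_gt_0_iff)
  have step: "\<theta> ^ weight n (w(i := w i \<oplus> a)) \<le>
      (if a = \<ominus> w i then \<theta> ^ weight n w / \<theta> else 0) + \<theta> ^ weight n w" if "a \<in> ?A" for a
  proof (cases "w i \<oplus> a = \<zero>")
    case z: True
    have "a = \<ominus> w i"
      using z that w i by (metis DiffD1 a_comm is_vec_def minus_equality)
    moreover have "weight n w = Suc (weight n w - 1)" using pos by simp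
    then have "\<theta> ^ weight n w / \<theta> = \<theta> ^ (weight n w - 1)"
      using \<theta> by (metis nonzero_mult_div_cancel_left power_Suc less_irrefl)
    ultimately show ?thesis using z i True \<theta> by (simp add: supp_upd)
  next
    case nz: False
    have "insert i (supp F n w) = supp F n w" using True by auto
    then show ?thesis using nz i \<theta> by (simp add: supp_upd)
  qed
  have "(\<Sum>a\<in>?A. \<theta> ^ weight n (w(i := w i \<oplus> a))) \<le>
      (\<Sum>a\<in>?A. (if a = \<ominus> w i then \<theta> ^ weight n w / \<theta> else 0) + \<theta> ^ weight n w)"
    by (intro sum_mono step)
  also have "\<dots> \<le> \<theta> ^ weight n w / \<theta> + units_card * \<theta> ^ weight n w"
    using finite_carrier \<theta> by (simp add: sum.distrib sum.delta)
  finally show ?thesis using True by (simp add: field_simps)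
qed

text \<open>Only the at most \<open>N\<close> sites of the support can gain
  \<open>1/\<theta>\<close>, while growth is possible on up to \<open>n\<close> sites;
  \<open>\<Lambda>\<close> bounds the total factor of one step.\<close>

lemma sum_step:
  fixes \<theta> \<Lambda> :: real
  assumes w: "is_vec n w" and \<theta>: "0 < \<theta>"
    and N: "weight n w \<le> N" and \<Lambda>: "N * (1 / \<theta> + units_card) + n * units_card * \<theta> \<le> \<Lambda>"
  shows "(\<Sum>i<n. \<Sum>a\<in>carrier F - {\<zero>}. \<theta> ^ weight n (w(i := w i \<oplus> a))) \<le> \<Lambda> * \<theta> ^ weight n w"
proof -
  \<comment> \<open>The growth term is charged to every site, including those of the support, so
    that the sum over sites splits.\<close>
  let ?g = "\<lambda>i. (if i \<in> supp F n w then 1 / \<theta> + units_card else 0) + units_card * \<theta>"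
  have "(\<Sum>i<n. \<Sum>a\<in>carrier F - {\<zero>}. \<theta> ^ weight n (w(i := w i \<oplus> a))) \<le>
      (\<Sum>i<n. \<theta> ^ weight n w * ?g i)"
  proof (rule sum_mono)
    fix i assume "i \<in> {..<n}"
    then have "(\<Sum>a\<in>carrier F - {\<zero>}. \<theta> ^ weight n (w(i := w i \<oplus> a))) \<le>
      \<theta> ^ weight n w * (if i \<in> supp F n w then 1 / \<theta> + units_card else units_card * \<theta>)"
      using sum_coordinate_step[OF w \<theta>] by simp
    also have "\<dots> \<le> \<theta> ^ weight n w * ?g i"
      using \<theta> by (intro mult_left_mono) auto
    finally show "(\<Sum>a\<in>carrier F - {\<zero>}. \<theta> ^ weight n (w(i := w i \<oplus> a))) \<le> \<theta> ^ weight n w * ?g i" .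
  qed
  also have "\<dots> = \<theta> ^ weight n w * (weight n w * (1 / \<theta> + units_card) + n * units_card * \<theta>)"
  proof -
    have "{i \<in> {..<n}. i \<in> supp F n w} = supp F n w" by (auto simp: supp_def)
    then have "(\<Sum>i<n. if i \<in> supp F n w then 1 / \<theta> + units_card else 0) = weight n w * (1 / \<theta> + units_card)"
      by (subst sum.inter_filter[symmetric]) auto
    then show ?thesis by (simp add: sum.distrib flip: sum_distrib_left)
  qed
  also have "\<dots> \<le> \<theta> ^ weight n w * (N * (1 / \<theta> + units_card) + n * units_card * \<theta>)"
    using N \<theta> by (intro mult_left_mono add_mono mult_right_mono) auto
  also have "\<dots> \<le> \<theta> ^ weight n w * \<Lambda>"
    using \<Lambda> \<theta> by (intro mult_left_mono) auto
  finally show ?thesis by (simp add: mult.commute)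
qed

lemma finite_sparse_vecs [simp]: "finite (sparse_vecs F n k)"
proof -
  have "finite ({..<n} \<rightarrow>\<^sub>E carrier F)" using finite_carrier by (intro finite_PiE) auto
  then show ?thesis by (simp add: sparse_vecs_def)
qed

lemma sparse_vecsD:
  assumes "u \<in> sparse_vecs F n k"
  shows "is_vec n u" "weight n u = k" "i < n \<Longrightarrow> u i \<in> carrier F" "u \<in> extensional {..<n}"
  using assms by (auto simp: sparse_vecs_def is_vec_def PiE_def)

lemma is_vec_add: "is_vec n w \<Longrightarrow> is_vec n u \<Longrightarrow> is_vec n (vec_add w u)"
  by (simp add: is_vec_def vec_add_def)

text \<open>A sparse vector is built by single-coordinate steps. The map hits vectors repeatedly and
  also leaves the target set, which is harmless for the upper bound in
  \<open>sum_sparse\<close>.\<close>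

lemma sparse_vecs_Suc_subset:
  "sparse_vecs F n (Suc k) \<subseteq>
    (\<lambda>(i, a, u). u(i := u i \<oplus> a)) ` ({..<n} \<times> (carrier F - {\<zero>}) \<times> sparse_vecs F n k)"
proof
  fix v assume v: "v \<in> sparse_vecs F n (Suc k)"
  have "supp F n v \<noteq> {}" using sparse_vecsD(2)[OF v] by auto
  then obtain i where i: "i \<in> supp F n v" by auto
  then have i': "i < n" "v i \<noteq> \<zero>" "v i \<in> carrier F" using sparse_vecsD(3)[OF v] by (auto simp: supp_def)
  have "v(i := \<zero>) \<in> sparse_vecs F n k"
    using v i i' by (auto simp: sparse_vecs_def supp_upd PiE_def extensional_def)
  moreover have "v = (v(i := \<zero>))(i := (v(i := \<zero>)) i \<oplus> v i)"
    using i' by auto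
  ultimately show "v \<in> (\<lambda>(i, a, u). u(i := u i \<oplus> a)) ` ({..<n} \<times> (carrier F - {\<zero>}) \<times> sparse_vecs F n k)"
    using i' by (intro image_eqI[of _ _ "(i, v i, v(i := \<zero>))"]) auto
qed

text \<open>One sparse vector is \<open>k\<close> steps of the walk, each costing a factor
  \<open>\<Lambda>\<close>. The hypothesis on \<open>N\<close> covers the weight at every
  intermediate step, since a step raises it by at most one.\<close>

lemma sum_sparse:
  fixes \<theta> \<Lambda> :: real
  assumes w: "is_vec n w" and \<theta>: "0 < \<theta>"
    and N: "weight n w + k \<le> N" and \<Lambda>: "N * (1 / \<theta> + units_card) + n * units_card * \<theta> \<le> \<Lambda>"
  shows "(\<Sum>u\<in>sparse_vecs F n k. \<theta> ^ weight n (vec_add w u)) \<le> \<Lambda> ^ k * \<theta> ^ weight n w"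
  using N
proof (induction k)
  case 0
  have *: "weight n (vec_add w u) = weight n w" if "u \<in> sparse_vecs F n 0" for u
  proof -
    have "supp F n u = {}" using sparse_vecsD(2)[OF that] by auto
    then have "supp F n (vec_add w u) = supp F n w"
      using w by (intro supp_cong) (auto simp: vec_add_def supp_def is_vec_def)
    then show ?thesis by simp
  qed
  have "sparse_vecs F n 0 \<subseteq> {\<lambda>i\<in>{..<n}. \<zero>}"
    by (auto simp: sparse_vecs_def supp_def PiE_def extensional_def fun_eq_iff)
  then have "card (sparse_vecs F n 0) \<le> 1"
    using card_mono[of "{\<lambda>i\<in>{..<n}. \<zero>}"] by fastforce
  then show ?case using * \<theta> by (simp add: mult_left_le_one_le)
next
  case (Suc k)
  let ?A = "{..<n} \<times> (carrier F - {\<zero>}) \<times> sparse_vecs F n k"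
  let ?h = "\<lambda>(i, a, u). u(i := u i \<oplus> a)"
  let ?g = "\<lambda>v. \<theta> ^ weight n (vec_add w v)"
  have \<Lambda>0: "0 \<le> \<Lambda>" using \<theta> by (intro order_trans[OF _ \<Lambda>] add_nonneg_nonneg mult_nonneg_nonneg) auto
  have finA: "finite ?A" using finite_carrier by simp
  have "(\<Sum>v\<in>sparse_vecs F n (Suc k). ?g v) \<le> (\<Sum>v\<in>?h ` ?A. ?g v)"
    using \<theta> finA by (intro sum_mono2 sparse_vecs_Suc_subset) auto
  also have "\<dots> \<le> (\<Sum>x\<in>?A. ?g (?h x))"
    using \<theta> finA sum_image_le[of ?A ?g ?h] by (simp add: o_def)
  also have "\<dots> = (\<Sum>i<n. \<Sum>a\<in>carrier F - {\<zero>}. \<Sum>u\<in>sparse_vecs F n k. ?g (u(i := u i \<oplus> a)))"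
    by (simp add: sum.cartesian_product split_def)
  also have "\<dots> = (\<Sum>i<n. \<Sum>u\<in>sparse_vecs F n k. \<Sum>a\<in>carrier F - {\<zero>}. ?g (u(i := u i \<oplus> a)))"
    by (rule sum.cong[OF HOL.refl], rule sum.swap)
  also have "\<dots> = (\<Sum>u\<in>sparse_vecs F n k. \<Sum>i<n. \<Sum>a\<in>carrier F - {\<zero>}. ?g (u(i := u i \<oplus> a)))"
    by (rule sum.swap)
  also have "\<dots> \<le> (\<Sum>u\<in>sparse_vecs F n k. \<Lambda> * \<theta> ^ weight n (vec_add w u))"
  proof (rule sum_mono)
    fix u assume u: "u \<in> sparse_vecs F n k"
    have "vec_add w (u(i := u i \<oplus> a)) j = ((vec_add w u)(i := vec_add w u i \<oplus> a)) j"
      if "i < n" "a \<in> carrier F" for i a j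
      using that w sparse_vecsD(3)[OF u] by (auto simp: vec_add_def is_vec_def a_assoc)
    then have "(\<Sum>i<n. \<Sum>a\<in>carrier F - {\<zero>}. ?g (u(i := u i \<oplus> a))) =
        (\<Sum>i<n. \<Sum>a\<in>carrier F - {\<zero>}. \<theta> ^ weight n ((vec_add w u)(i := vec_add w u i \<oplus> a)))"
      by (intro sum.cong arg_cong[where f = "\<lambda>w. \<theta> ^ weight n w"]) auto
    also have "\<dots> \<le> \<Lambda> * \<theta> ^ weight n (vec_add w u)"
      using weight_vec_add_le[of n w u] sparse_vecsD(1,2)[OF u] Suc.prems w
      by (intro sum_step[OF _ \<theta> _ \<Lambda>] is_vec_add) auto
    finally show "(\<Sum>i<n. \<Sum>a\<in>carrier F - {\<zero>}. ?g (u(i := u i \<oplus> a))) \<le> \<Lambda> * \<theta> ^ weight n (vec_add w u)" .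
  qed
  also have "\<dots> = \<Lambda> * (\<Sum>u\<in>sparse_vecs F n k. ?g u)"
    by (simp add: sum_distrib_left)
  also have "\<dots> \<le> \<Lambda> * (\<Lambda> ^ k * \<theta> ^ weight n w)"
    using Suc \<Lambda>0 by (intro mult_left_mono) auto
  finally show ?case by simp
qed

lemma sum_sparse_lists:
  fixes \<theta> \<Lambda> :: real
  assumes w: "is_vec n w" and \<theta>: "0 < \<theta>"
    and N: "weight n w + k * s \<le> N" and \<Lambda>: "N * (1 / \<theta> + units_card) + n * units_card * \<theta> \<le> \<Lambda>"
  shows "(\<Sum>us | set us \<subseteq> sparse_vecs F n k \<and> length us = s. \<theta> ^ weight n (foldl vec_add w us))
    \<le> \<Lambda> ^ (k * s) * \<theta> ^ weight n w"
  using w N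
proof (induction s arbitrary: w)
  case 0
  have "{us. set us \<subseteq> sparse_vecs F n k \<and> length us = 0} = {[]}" by auto
  then show ?case by simp
next
  case (Suc s)
  let ?V = "sparse_vecs F n k"
  let ?L = "\<lambda>s. {us. set us \<subseteq> ?V \<and> length us = s}"
  have \<Lambda>0: "0 \<le> \<Lambda>" using \<theta> by (intro order_trans[OF _ \<Lambda>] add_nonneg_nonneg mult_nonneg_nonneg) auto
  have L: "?L (Suc s) = (\<lambda>(u, us). u # us) ` (?V \<times> ?L s)"
    by (auto simp: length_Suc_conv image_iff)
  have "(\<Sum>us\<in>?L (Suc s). \<theta> ^ weight n (foldl vec_add w us)) =
      (\<Sum>x\<in>?V \<times> ?L s. \<theta> ^ weight n (foldl vec_add (vec_add w (fst x)) (snd x)))"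
    unfolding L by (subst sum.reindex) (auto simp: inj_on_def split_def)
  also have "\<dots> = (\<Sum>u\<in>?V. \<Sum>us\<in>?L s. \<theta> ^ weight n (foldl vec_add (vec_add w u) us))"
    by (simp add: sum.cartesian_product split_def)
  also have "\<dots> \<le> (\<Sum>u\<in>?V. \<Lambda> ^ (k * s) * \<theta> ^ weight n (vec_add w u))"
  proof (rule sum_mono)
    fix u assume u: "u \<in> ?V"
    have "weight n (vec_add w u) + k * s \<le> N"
      using weight_vec_add_le[of n w u] sparse_vecsD(2)[OF u] Suc.prems by simp
    then show "(\<Sum>us\<in>?L s. \<theta> ^ weight n (foldl vec_add (vec_add w u) us)) \<le>
        \<Lambda> ^ (k * s) * \<theta> ^ weight n (vec_add w u)"
      using Suc.IH is_vec_add sparse_vecsD(1)[OF u] Suc.prems by blast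
  qed
  also have "\<dots> = \<Lambda> ^ (k * s) * (\<Sum>u\<in>?V. \<theta> ^ weight n (vec_add w u))"
    by (simp add: sum_distrib_left)
  also have "\<dots> \<le> \<Lambda> ^ (k * s) * (\<Lambda> ^ k * \<theta> ^ weight n w)"
    using Suc.prems \<Lambda>0 by (intro mult_left_mono sum_sparse[OF _ \<theta> _ \<Lambda>]) auto
  finally show ?case by (simp add: power_add algebra_simps)
qed

text \<open>Markov's inequality for the potential: since \<open>\<theta> \<le> 1\<close>, an end
  point of weight at most \<open>D\<close> has potential at least \<open>\<theta> ^ D\<close>. The
  walk starts at the origin, so its weight never exceeds its length \<open>k * s\<close>, which
  takes the place of \<open>N\<close>.\<close>

lemma card_low_weight_lists:
  fixes \<theta> \<Lambda> :: real
  assumes \<theta>: "0 < \<theta>" "\<theta> \<le> 1" and \<Lambda>: "real (k * s) * (1 / \<theta> + units_card) + n * units_card * \<theta> \<le> \<Lambda>"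
  shows "real (card {us. set us \<subseteq> sparse_vecs F n k \<and> length us = s \<and>
      weight n (foldl vec_add (\<lambda>_. \<zero>) us) \<le> D}) * \<theta> ^ D \<le> \<Lambda> ^ (k * s)"
proof -
  let ?L = "{us. set us \<subseteq> sparse_vecs F n k \<and> length us = s}"
  let ?z = "\<lambda>_::nat. \<zero>"
  have finL: "finite ?L" by (rule finite_lists_length_eq) simp
  have "real (card {us \<in> ?L. weight n (foldl vec_add ?z us) \<le> D}) * \<theta> ^ D =
      (\<Sum>us\<in>{us \<in> ?L. weight n (foldl vec_add ?z us) \<le> D}. \<theta> ^ D)" by simp
  also have "\<dots> \<le> (\<Sum>us\<in>{us \<in> ?L. weight n (foldl vec_add ?z us) \<le> D}. \<theta> ^ weight n (foldl vec_add ?z us))"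
    using \<theta> by (intro sum_mono power_decreasing) auto
  also have "\<dots> \<le> (\<Sum>us\<in>?L. \<theta> ^ weight n (foldl vec_add ?z us))"
    using \<theta> finL by (intro sum_mono2) auto
  also have "\<dots> \<le> \<Lambda> ^ (k * s) * \<theta> ^ weight n ?z"
    by (intro sum_sparse_lists[OF _ \<theta>(1) _ \<Lambda>]) (auto simp: is_vec_def supp_def)
  also have "weight n ?z = 0" by (simp add: supp_def)
  finally show ?thesis by simp
qed

text \<open>The coefficients are nonzero on all of \<open>S\<close>, so \<open>S\<close> is the
  exact set of equations that the combination uses and \<open>s\<close> is its size. With
  \<open>D = 0\<close> the vanishing combinations are included.\<close>

definition bad_sets :: "nat \<Rightarrow> nat \<Rightarrow> nat \<Rightarrow> nat \<Rightarrow> (nat \<Rightarrow> 'a) set set" where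
  "bad_sets n k s D = {S. S \<subseteq> sparse_vecs F n k \<and> card S = s \<and>
     (\<exists>\<gamma>\<in>S \<rightarrow> carrier F - {\<zero>}. weight n (combination S \<gamma>) \<le> D)}"

text \<open>The restriction to \<open>{..<n}\<close> keeps the result extensional, hence inside
  \<open>sparse_vecs\<close>.\<close>

definition vec_scale :: "nat \<Rightarrow> 'a \<Rightarrow> (nat \<Rightarrow> 'a) \<Rightarrow> nat \<Rightarrow> 'a" where
  "vec_scale n c v = (\<lambda>i\<in>{..<n}. c \<otimes> v i)"

lemma vec_scale_sparse:
  assumes "v \<in> sparse_vecs F n k" "c \<in> carrier F - {\<zero>}"
  shows "vec_scale n c v \<in> sparse_vecs F n k"
proof -
  have "supp F n (vec_scale n c v) = supp F n v"
    using assms sparse_vecsD(3)[OF assms(1)] by (auto simp: supp_def vec_scale_def integral_iff)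
  then show ?thesis
    using assms sparse_vecsD(3)[OF assms(1)] by (auto simp: sparse_vecs_def vec_scale_def)
qed

lemma vec_scale_inj:
  assumes "v \<in> sparse_vecs F n k" "v' \<in> sparse_vecs F n k" "c \<in> carrier F - {\<zero>}"
    and eq: "vec_scale n c v = vec_scale n c v'"
  shows "v = v'"
proof (rule extensionalityI)
  fix i assume i: "i \<in> {..<n}"
  have "c \<otimes> v i = c \<otimes> v' i" using fun_cong[OF eq, of i] i by (simp add: vec_scale_def)
  then show "v i = v' i"
    using assms i sparse_vecsD(3)[OF assms(1)] sparse_vecsD(3)[OF assms(2)] by (simp add: m_lcancel)
qed (use assms sparse_vecsD(4) in auto)

lemma foldl_vec_add:
  assumes "distinct xs" "\<And>x. x \<in> set xs \<Longrightarrow> g x i \<in> carrier F" "w i \<in> carrier F"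
  shows "foldl vec_add w (map g xs) i = w i \<oplus> (\<Oplus>x\<in>set xs. g x i)"
  using assms
proof (induction xs arbitrary: w)
  case (Cons x xs)
  then have "foldl vec_add (vec_add w (g x)) (map g xs) i = vec_add w (g x) i \<oplus> (\<Oplus>x\<in>set xs. g x i)"
    by (intro Cons.IH) (auto simp: vec_add_def)
  moreover have "vec_add w (g x) i = w i \<oplus> g x i" by (simp add: vec_add_def)
  ultimately show ?case using Cons.prems by (simp add: finsum_insert a_assoc Pi_iff)
qed simp

text \<open>
  Each bad set has \<open>s!\<close> orderings; an ordering is recovered from the list of its coefficients and
  the list of its rescaled vectors.
\<close>

lemma card_bad_sets:
  "fact s * card (bad_sets n k s D) \<le> units_card ^ s *
    card {us. set us \<subseteq> sparse_vecs F n k \<and> length us = s \<and> weight n (foldl vec_add (\<lambda>_. \<zero>) us) \<le> D}"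
    (is "_ \<le> _ * card ?U")
proof -
  let ?V = "sparse_vecs F n k" and ?B = "bad_sets n k s D"
  define \<Gamma> where "\<Gamma> S = (SOME \<gamma>. \<gamma> \<in> S \<rightarrow> carrier F - {\<zero>} \<and> weight n (combination S \<gamma>) \<le> D)" for S
  have \<Gamma>: "\<Gamma> S \<in> S \<rightarrow> carrier F - {\<zero>} \<and> weight n (combination S (\<Gamma> S)) \<le> D" if "S \<in> ?B" for S
  proof -
    have "\<exists>\<gamma>. \<gamma> \<in> S \<rightarrow> carrier F - {\<zero>} \<and> weight n (combination S \<gamma>) \<le> D"
      using that unfolding bad_sets_def by blast
    then show ?thesis unfolding \<Gamma>_def by (rule someI_ex)
  qed
  have B: "S \<subseteq> ?V" "card S = s" "finite S" if "S \<in> ?B" for S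
    using that finite_subset[of S ?V] by (auto simp: bad_sets_def)
  have finB: "finite ?B"
    by (rule finite_subset[of _ "Pow ?V"]) (auto simp: bad_sets_def)
  define X where "X = (\<Union>S\<in>?B. permutations_of_set S)"
  define Z where "Z = {cs. set cs \<subseteq> carrier F - {\<zero>} \<and> length cs = s}"
  have finZ: "finite Z" "card Z = units_card ^ s"
    unfolding Z_def using finite_carrier by (auto intro: finite_lists_length_eq simp: card_lists_length_eq)
  have finU: "finite ?U"
    by (rule finite_subset[OF _ finite_lists_length_eq[of ?V s]]) auto
  have X: "distinct xs" "set xs \<in> ?B" "length xs = s" if "xs \<in> X" for xs
  proof -
    show "distinct xs" "set xs \<in> ?B" using that by (auto simp: X_def permutations_of_set_def)
    then show "length xs = s" using B(2)[of "set xs"] distinct_card[of xs] by simp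
  qed
  have "card X = (\<Sum>S\<in>?B. card (permutations_of_set S))"
    unfolding X_def
  proof (rule card_UN_disjoint[OF finB])
    show "\<forall>S\<in>?B. finite (permutations_of_set S)" by simp
  qed (auto simp: permutations_of_set_def)
  also have "\<dots> = fact s * card ?B"
    using B by (simp add: mult.commute)
  finally have cardX: "card X = fact s * card ?B" .
  define h where "h xs = (map (\<Gamma> (set xs)) xs, map (\<lambda>v. vec_scale n (\<Gamma> (set xs) v) v) xs)" for xs
  have inj: "inj_on h X"
  proof (rule inj_onI)
    fix xs ys assume xs: "xs \<in> X" and ys: "ys \<in> X" and eq: "h xs = h ys"
    show "xs = ys"
    proof (rule nth_equalityI)
      show len: "length xs = length ys" using X xs ys by simp
      fix j assume j: "j < length xs"
      have jx: "xs ! j \<in> set xs" "ys ! j \<in> set ys" using j len by auto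
      have c: "\<Gamma> (set xs) (xs ! j) = \<Gamma> (set ys) (ys ! j)"
        using arg_cong[OF eq, of "\<lambda>z. fst z ! j"] j len by (simp add: h_def)
      have "vec_scale n (\<Gamma> (set xs) (xs ! j)) (xs ! j) = vec_scale n (\<Gamma> (set ys) (ys ! j)) (ys ! j)"
        using arg_cong[OF eq, of "\<lambda>z. snd z ! j"] j len by (simp add: h_def)
      moreover have "\<Gamma> (set xs) (xs ! j) \<in> carrier F - {\<zero>}"
        using \<Gamma>[OF X(2)[OF xs]] jx by blast
      moreover have "xs ! j \<in> ?V" "ys ! j \<in> ?V" using B X xs ys jx by blast+
      ultimately show "xs ! j = ys ! j"
        using vec_scale_inj[of "xs ! j" n k "ys ! j" "\<Gamma> (set xs) (xs ! j)"] unfolding c by blast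
    qed
  qed
  have "h ` X \<subseteq> Z \<times> ?U"
  proof
    fix z assume "z \<in> h ` X"
    then obtain xs where xs: "xs \<in> X" and z: "z = h xs" by auto
    let ?\<gamma> = "\<Gamma> (set xs)"
    note S = X(2)[OF xs]
    have g: "?\<gamma> v \<in> carrier F - {\<zero>}" if "v \<in> set xs" for v
      using \<Gamma>[OF S] that by blast
    have "foldl vec_add (\<lambda>_. \<zero>) (map (\<lambda>v. vec_scale n (?\<gamma> v) v) xs) i = combination (set xs) ?\<gamma> i"
      if i: "i < n" for i
    proof -
      have c: "?\<gamma> v \<otimes> v i \<in> carrier F" if "v \<in> set xs" for v
        using g[OF that] B(1)[OF S] that sparse_vecsD(3) i by blast
      have "foldl vec_add (\<lambda>_. \<zero>) (map (\<lambda>v. vec_scale n (?\<gamma> v) v) xs) i =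
          \<zero> \<oplus> (\<Oplus>v\<in>set xs. vec_scale n (?\<gamma> v) v i)"
        using X(1)[OF xs] c i by (intro foldl_vec_add) (auto simp: vec_scale_def)
      then show ?thesis using c i by (simp add: combination_def vec_scale_def Pi_iff finsum_closed)
    qed
    then have "supp F n (foldl vec_add (\<lambda>_. \<zero>) (map (\<lambda>v. vec_scale n (?\<gamma> v) v) xs)) =
        supp F n (combination (set xs) ?\<gamma>)"
      by (rule supp_cong)
    moreover have "vec_scale n (?\<gamma> v) v \<in> ?V" if "v \<in> set xs" for v
      using g[OF that] B(1)[OF S] that vec_scale_sparse by blast
    ultimately have "map (\<lambda>v. vec_scale n (?\<gamma> v) v) xs \<in> ?U"
      using X(3)[OF xs] \<Gamma>[OF S] by (simp add: image_subset_iff)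
    moreover have "map ?\<gamma> xs \<in> Z"
      using g X(3)[OF xs] by (auto simp: Z_def)
    ultimately show "z \<in> Z \<times> ?U"
      unfolding z h_def by (rule SigmaI[rotated])
  qed
  then have "card (h ` X) \<le> card (Z \<times> ?U)"
    by (rule card_mono[rotated]) (intro finite_cartesian_product finZ(1) finU)
  then show ?thesis
    unfolding card_image[OF inj] cardX card_cartesian_product finZ(2) .
qed

text \<open>Bounds from below the denominator \<open>|V|\<close> of the density
  \<open>m / |V|\<close>; an injection from pairs of a support and its nonzero values suffices for
  that.\<close>

lemma card_sparse_vecs_ge: "(n choose k) * units_card ^ k \<le> card (sparse_vecs F n k)"
proof -
  let ?I = "{I. I \<subseteq> {..<n} \<and> card I = k}"
  let ?A = "Sigma ?I (\<lambda>I. I \<rightarrow>\<^sub>E (carrier F - {\<zero>}))"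
  let ?h = "\<lambda>(I, f). \<lambda>i\<in>{..<n}. if i \<in> I then f i else \<zero>"
  have finI: "finite I" if "I \<in> ?I" for I using that finite_subset by auto
  have supp: "supp F n (?h (I, f)) = I" if "I \<in> ?I" "f \<in> I \<rightarrow>\<^sub>E (carrier F - {\<zero>})" for I f
    using that by (auto simp: supp_def)
  have inj: "inj_on ?h ?A"
  proof (rule inj_onI, clarify)
    fix I f I' f'
    assume I: "I \<subseteq> {..<n}" "k = card I" "f \<in> I \<rightarrow>\<^sub>E (carrier F - {\<zero>})"
      and I': "I' \<subseteq> {..<n}" "card I' = card I" "f' \<in> I' \<rightarrow>\<^sub>E (carrier F - {\<zero>})"
      and eq: "(\<lambda>i\<in>{..<n}. if i \<in> I then f i else \<zero>) = (\<lambda>i\<in>{..<n}. if i \<in> I' then f' i else \<zero>)"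
    have "I = supp F n (?h (I, f))" by (rule supp[symmetric]) (use I in auto)
    also have "\<dots> = supp F n (?h (I', f'))" unfolding prod.case eq by (rule HOL.refl)
    also have "\<dots> = I'" by (rule supp) (use I I' in auto)
    finally have "I = I'" .
    have "f i = f' i" if "i \<in> I" for i
      using fun_cong[OF eq, of i] that I \<open>I = I'\<close> by (auto split: if_splits)
    moreover have "I = I'" by fact
    moreover have "f' \<in> I \<rightarrow>\<^sub>E (carrier F - {\<zero>})" unfolding \<open>I = I'\<close> by (rule I'(3))
    ultimately show "I = I' \<and> f = f'" using PiE_ext[OF I(3)] by blast
  qed
  have sub: "?h ` ?A \<subseteq> sparse_vecs F n k"
  proof
    fix v assume "v \<in> ?h ` ?A"
    then obtain I f where If: "I \<in> ?I" "f \<in> I \<rightarrow>\<^sub>E (carrier F - {\<zero>})" "v = ?h (I, f)" by auto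
    have "weight n v = k" using supp[OF If(1,2)] If(1,3) by simp
    moreover have "f i \<in> carrier F" if "i \<in> I" for i
      using PiE_mem[OF If(2) that] by simp
    then have "v \<in> {..<n} \<rightarrow>\<^sub>E carrier F" unfolding If(3) by simp
    ultimately show "v \<in> sparse_vecs F n k" by (simp add: sparse_vecs_def)
  qed
  have "card ?A = (\<Sum>I\<in>?I. card (I \<rightarrow>\<^sub>E (carrier F - {\<zero>})))"
    using finI finite_carrier by (intro card_SigmaI) (auto intro!: finite_PiE)
  also have "\<dots> = (\<Sum>I\<in>?I. units_card ^ k)"
    using finI by (intro sum.cong) (auto simp: card_PiE)
  also have "\<dots> = (n choose k) * units_card ^ k" by (simp add: n_subsets)
  finally show ?thesis
    using card_mono[OF finite_sparse_vecs sub] card_image[OF inj] by simp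
qed

end

subsection \<open>Random instances\<close>

text \<open>The quotient \<open>s^s / s!\<close> is one term of the series of \<open>exp s\<close>.
  It converts the \<open>s!\<close> orderings of a bad set into \<open>(s/e)^s\<close>.\<close>

lemma self_power_le_exp_fact: "real s ^ s \<le> exp (real s) * fact s"
proof -
  have "(\<Sum>n\<in>{s}. inverse (fact n) * real s ^ n) \<le> suminf (\<lambda>n. inverse (fact n) * real s ^ n)"
    by (intro sum_le_suminf summable_exp) auto
  also have "\<dots> = exp (real s)"
    by (simp add: exp_def)
  finally show ?thesis by (simp add: field_simps)
qed

text \<open>The third hypothesis makes each base at most \<open>1/4\<close>. One factor of the base
  is kept aside, because its \<open>1 / sqrt l\<close> is what makes the failure probability vanish;
  the remaining powers of \<open>1/4\<close> absorb \<open>sqrt s\<close> and leave a geometric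
  series.\<close>

lemma sum_small_powers:
  fixes R l :: real
  assumes "0 \<le> R" "0 < l" "16 * R\<^sup>2 * T \<le> l"
  shows "(\<Sum>s=1..T. (R * sqrt (s / l)) ^ s) \<le> 2 * R / sqrt l"
proof -
  have step: "(R * sqrt (s / l)) ^ s \<le> R / sqrt l * (1 / 2) ^ (s - 1)" if s: "s \<in> {1..T}" for s
  proof -
    let ?x = "R * sqrt (s / l)"
    have x0: "0 \<le> ?x" using assms by simp
    have "16 * R\<^sup>2 * s \<le> l"
      using s assms by (intro order_trans[OF mult_left_mono assms(3)]) auto
    then have "?x\<^sup>2 \<le> (1 / 4)\<^sup>2"
      using assms by (simp add: power_mult_distrib field_simps)
    then have x: "?x \<le> 1 / 4" by (rule power2_le_imp_le) simp
    have "s = Suc (s - 1)" using s by simp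
    then have "?x ^ s = ?x * ?x ^ (s - 1)" by (metis power_Suc)
    also have "\<dots> \<le> ?x * (1 / 4) ^ (s - 1)"
      using x x0 by (intro mult_left_mono power_mono) auto
    also have "\<dots> = R / sqrt l * (sqrt s * (1 / 4) ^ (s - 1))"
      by (simp add: real_sqrt_divide)
    also have "\<dots> \<le> R / sqrt l * (2 ^ (s - 1) * (1 / 4) ^ (s - 1))"
    proof -
      have "s \<le> 2 ^ (s - 1)"
      proof (cases "s - 1")
        case 0
        then show ?thesis using s by simp
      next
        case (Suc j)
        have "Suc j < 2 ^ Suc j" by (rule less_exp)
        then show ?thesis using Suc by (simp add: Suc_le_eq)
      qed
      then have "real s \<le> 2 ^ (s - 1)" by (metis of_nat_le_iff of_nat_numeral of_nat_power)
      moreover have "sqrt s \<le> s"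
      proof (rule real_le_lsqrt)
        have "1 * real s \<le> real s * real s" using s by (intro mult_right_mono) auto
        then show "real s \<le> (real s)\<^sup>2" by (simp add: power2_eq_square)
      qed simp
      ultimately have "sqrt s \<le> 2 ^ (s - 1)" by linarith
      then show ?thesis
        using assms by (intro mult_left_mono mult_right_mono) auto
    qed
    also have "2 ^ (s - 1) * (1 / 4) ^ (s - 1) = (1 / 2 :: real) ^ (s - 1)"
      by (simp flip: power_mult_distrib)
    finally show ?thesis .
  qed
  have "(\<Sum>s=1..T. (R * sqrt (s / l)) ^ s) \<le> (\<Sum>s=1..T. R / sqrt l * (1 / 2) ^ (s - 1))"
    by (intro sum_mono step)
  also have "\<dots> = R / sqrt l * (\<Sum>s<T. (1 / 2) ^ s)"
    unfolding sum_distrib_left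
    by (rule sum.reindex_bij_witness[of _ Suc "\<lambda>s. s - 1"]) auto
  also have "\<dots> \<le> R / sqrt l * 2"
  proof (rule mult_left_mono)
    show "(\<Sum>s<T. (1 / 2 :: real) ^ s) \<le> 2"
      by (subst sum_gp_strict) (simp add: field_simps)
  qed (use assms in simp)
  finally show ?thesis by (simp add: mult.commute)
qed

text \<open>The left side is the base whose \<open>s\<close>-th power bounds the expected number of
  bad sets of size \<open>s\<close>. With \<open>N = nq\<close> and \<open>h = k/2 - 1\<close>, the
  count contributes \<open>(sN)^(h+1) / s\<close>, the density contributes
  \<open>N^(h+1) / l^h\<close> over \<open>N^k = N^(2h+2)\<close>, and only \<open>(s/l)^h\<close>
  remains up to constants. Since \<open>k \<ge> 3\<close> gives \<open>h \<ge> 1/2\<close> and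
  \<open>s \<le> l\<close>, this is at most \<open>sqrt (s/l)\<close>. In the constant, 2 is the
  upper constant for \<open>m\<close>, \<open>3^k\<close> comes from \<open>\<Lambda>\<close>, one
  \<open>k^k\<close> from the walk length and the other from \<open>(nq/k)^k\<close>.\<close>

lemma density_bound:
  fixes \<epsilon> l N q n m s :: real and k :: nat
  assumes k: "k \<ge> 3" and pos: "0 < \<epsilon>" "0 < l" "0 < q" "0 < n" "0 < s" "s \<le> l" "0 \<le> m"
    and m: "m \<le> 2 * n * (n * q / l) powr (k / 2 - 1) / \<epsilon>\<^sup>2"
  shows "q * m * (3 * sqrt (k * s * (n * q))) ^ k * exp 2 / (s * (n * q / k) ^ k)
    \<le> (2 * exp 2 * 3 ^ k * real k ^ k * real k ^ k / \<epsilon>\<^sup>2) * sqrt (s / l)"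
proof -
  define N where "N = n * q"
  define h where "h = real k / 2 - 1"
  have h: "h \<ge> 1 / 2" using k by (simp add: h_def)
  have N: "N > 0" using pos by (simp add: N_def)
  have k0: "real k > 0" using k by simp
  have sq: "sqrt (k * s * N) ^ k = k powr (h + 1) * (s powr h * s) * (N powr h * N)"
  proof -
    have "sqrt (k * s * N) ^ k = (k * s * N) powr (k / 2)"
      using k0 pos N by (simp add: powr_half_sqrt[symmetric] powr_powr powr_realpow[symmetric])
    also have "real k / 2 = h + 1" by (simp add: h_def)
    finally show ?thesis using pos N k0 by (simp add: powr_mult powr_add)
  qed
  have Nk: "N ^ k = (N powr h * N)\<^sup>2"
  proof -
    have "N ^ k = N powr (h + 1 + (h + 1))" using N by (simp add: h_def powr_realpow)
    also have "\<dots> = (N powr h * N)\<^sup>2" using N by (simp only: powr_add power2_eq_square) simp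
    finally show ?thesis .
  qed
  have kh: "k powr (h + 1) \<le> real k ^ k"
    using k by (subst powr_realpow[symmetric]) (auto intro!: powr_mono simp: h_def)
  have qm: "q * m \<le> 2 * N * (N powr h / l powr h) / \<epsilon>\<^sup>2"
  proof -
    have "q * m \<le> q * (2 * n * (N / l) powr h / \<epsilon>\<^sup>2)"
      using m pos by (intro mult_left_mono) (auto simp: N_def h_def)
    then show ?thesis using pos N by (simp add: N_def powr_divide mult_ac)
  qed
  define a b where "a = s powr h" and "b = N powr h * N"
  have ab: "a > 0" "b > 0" using pos N by (auto simp: a_def b_def)
  have "q * m * (3 * sqrt (k * s * N)) ^ k * exp 2 / (s * (N / k) ^ k)
      = (q * m) * (3 ^ k * k powr (h + 1) * exp 2 * real k ^ k * a / b)"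
    unfolding power_mult_distrib sq power_divide Nk a_def[symmetric] b_def[symmetric]
    using ab pos k0 by (simp add: field_simps power2_eq_square)
  also have "\<dots> \<le> (2 * N * (N powr h / l powr h) / \<epsilon>\<^sup>2) * (3 ^ k * real k ^ k * exp 2 * real k ^ k * a / b)"
    using qm kh ab pos N by (intro mult_mono divide_right_mono mult_right_mono mult_left_mono) auto
  also have "\<dots> = (2 * exp 2 * 3 ^ k * real k ^ k * real k ^ k / \<epsilon>\<^sup>2) * (s / l) powr h"
    using N pos unfolding a_def b_def by (simp add: field_simps powr_divide)
  also have "\<dots> \<le> (2 * exp 2 * 3 ^ k * real k ^ k * real k ^ k / \<epsilon>\<^sup>2) * (s / l) powr (1 / 2)"
    using h pos by (intro mult_left_mono powr_mono') auto
  also have "(s / l) powr (1 / 2) = sqrt (s / l)" using pos by (intro powr_half_sqrt) simp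
  finally show ?thesis by (simp add: N_def mult_ac)
qed

section \<open>Probability of containing a bad set\<close>

context finite_field
begin

lemma units_card_pos: "0 < units_card"
proof -
  have "\<one> \<in> carrier F - {\<zero>}" by simp
  then show ?thesis unfolding card_gt_0_iff using finite_carrier by blast
qed

lemma card_carrier_Suc: "card (carrier F) = Suc units_card"
  using card_Suc_Diff1[OF finite_carrier zero_closed] by simp

text \<open>Of the two factors \<open>e^s\<close>, one comes from replacing \<open>s!\<close> by
  \<open>s^s\<close> and one from the weight allowance \<open>D\<close>.\<close>

lemma bad_sets_bound:
  assumes "0 < k" "0 < s" and size: "k * s * units_card \<le> n"
    and D: "real D * ln (real units_card * real n) \<le> s"
  shows "real (card (bad_sets n k s D)) * real s ^ s \<le>
    (units_card * (3 * sqrt (real k * s * (real n * units_card))) ^ k * exp 2) ^ s"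
proof -
  define z where "z = real k * s"
  define N where "N = real n * units_card"
  \<comment> \<open>Equalises the cancelling term \<open>z / \<theta>\<close> and the growth term
    \<open>N * \<theta>\<close>; both become \<open>sqrt (z * N)\<close>.\<close>
  define \<theta> where "\<theta> = sqrt (z / N)"
  define \<Lambda> where "\<Lambda> = 3 * sqrt (z * N)"
  have q: "real units_card \<ge> 1" using units_card_pos by simp
  have z: "z \<ge> 1" using assms(1,2) by (simp add: z_def flip: of_nat_mult)
  have zq: "z * units_card \<le> n"
    using size unfolding z_def by (metis of_nat_le_iff of_nat_mult)
  have "z * 1 \<le> z * units_card" using q z by (intro mult_left_mono) auto
  then have zn: "z \<le> n" and n1: "1 \<le> real n" using zq z by linarith+
  have "real n * 1 \<le> N" unfolding N_def using q by (intro mult_left_mono) auto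
  then have N1: "1 \<le> N" and zN: "z \<le> N" using n1 zn by linarith+
  have \<theta>: "0 < \<theta>" "\<theta> \<le> 1" using z N1 zN by (auto simp: \<theta>_def)
  have "z / \<theta> = sqrt (z * N)"
    using z N1 by (simp add: \<theta>_def real_sqrt_divide real_sqrt_mult field_simps)
  moreover have "n * units_card * \<theta> = sqrt (z * N)"
  proof -
    have "N * \<theta> = sqrt (z * N)"
      using z N1 by (simp add: \<theta>_def real_sqrt_divide real_sqrt_mult field_simps)
    then show ?thesis by (simp add: N_def)
  qed
  \<comment> \<open>The steps that change a coordinate without cancelling it form the third term. It
    is no larger than the other two because \<open>k * s * q \<le> n\<close>, hence the 3 in
    \<open>\<Lambda>\<close>.\<close>
  moreover have "z * units_card \<le> sqrt (z * N)"
  proof (rule real_le_rsqrt)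
    have "(z * units_card)\<^sup>2 = (z * units_card) * (z * units_card)" by (simp add: power2_eq_square)
    also have "\<dots> \<le> (z * units_card) * n" using zq z by (intro mult_left_mono) auto
    finally show "(z * units_card)\<^sup>2 \<le> z * N" by (simp add: N_def mult_ac)
  qed
  ultimately have \<Lambda>: "real (k * s) * (1 / \<theta> + units_card) + n * units_card * \<theta> \<le> \<Lambda>"
    by (simp add: \<Lambda>_def ring_distribs z_def)
  let ?U = "card {us. set us \<subseteq> sparse_vecs F n k \<and> length us = s \<and> weight n (foldl vec_add (\<lambda>_. \<zero>) us) \<le> D}"
  \<comment> \<open>Gives \<open>\<theta>^(-D) \<le> N^D\<close>, and the hypothesis on
    \<open>D\<close> bounds \<open>N^D\<close> by \<open>e^s\<close>.\<close>
  have "1 \<le> \<theta> * N"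
  proof -
    have "1 \<le> sqrt (z * N)" using z N1 by (simp add: mult_ge1_I)
    also have "\<dots> = \<theta> * N"
      using z N1 by (simp add: \<theta>_def real_sqrt_divide real_sqrt_mult field_simps)
    finally show ?thesis .
  qed
  then have "1 \<le> (\<theta> * N) ^ D" by (rule one_le_power)
  also have "N ^ D \<le> exp s"
  proof -
    have "N ^ D = exp (D * ln N)" using N1 by (simp add: exp_of_nat_mult)
    also have "\<dots> \<le> exp s" using D by (simp add: N_def mult.commute)
    finally show ?thesis .
  qed
  then have "(\<theta> * N) ^ D \<le> \<theta> ^ D * exp s"
    using \<theta> by (simp add: power_mult_distrib)
  finally have "real ?U * 1 \<le> real ?U * (\<theta> ^ D * exp s)" by (intro mult_left_mono) auto
  also have "\<dots> = (real ?U * \<theta> ^ D) * exp s" by simp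
  also have "\<dots> \<le> \<Lambda> ^ (k * s) * exp s"
    using card_low_weight_lists[OF \<theta> \<Lambda>] by (intro mult_right_mono) auto
  finally have U: "real ?U \<le> \<Lambda> ^ (k * s) * exp s" by simp
  have "real (card (bad_sets n k s D)) * real s ^ s \<le> real (card (bad_sets n k s D)) * (exp s * fact s)"
    by (intro mult_left_mono self_power_le_exp_fact) auto
  also have "\<dots> = exp s * real (fact s * card (bad_sets n k s D))" by simp
  also have "\<dots> \<le> exp s * real (units_card ^ s * ?U)"
    using card_bad_sets[of s n k D] by (intro mult_left_mono, subst of_nat_le_iff) auto
  also have "\<dots> = exp s * real units_card ^ s * real ?U" by simp
  also have "\<dots> \<le> exp s * real units_card ^ s * (\<Lambda> ^ (k * s) * exp s)"
    using U by (intro mult_left_mono) auto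
  also have "\<dots> = (units_card * \<Lambda> ^ k * exp 2) ^ s"
    by (simp add: power_mult_distrib power_mult mult_ac flip: exp_of_nat_mult exp_add)
  finally show ?thesis by (simp add: \<Lambda>_def z_def N_def)
qed

lemma card_sparse_vecs_real_ge:
  assumes "k \<le> n" "0 < k"
  shows "(real n * units_card / k) ^ k \<le> card (sparse_vecs F n k)"
proof -
  have "(real n * units_card / k) ^ k = (real n / k) ^ k * real units_card ^ k"
    by (simp flip: power_mult_distrib)
  also have "\<dots> \<le> real (n choose k) * real units_card ^ k"
    using binomial_ge_n_over_k_pow_k[OF assms(1), where 'a = real] by (intro mult_right_mono) auto
  also have "\<dots> \<le> card (sparse_vecs F n k)"
    using card_sparse_vecs_ge[of n k] by (metis of_nat_le_iff of_nat_mult of_nat_power)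
  finally show ?thesis .
qed

text \<open>When the logarithm is positive, this is the largest \<open>D\<close> with
  \<open>(qn)^D \<le> e^s\<close>, that is, the largest weight allowance that
  \<open>bad_sets_bound\<close> admits for size \<open>s\<close>.\<close>

definition threshold :: "nat \<Rightarrow> nat \<Rightarrow> nat" where
  "threshold n s = nat \<lfloor>real s / ln (real units_card * real n)\<rfloor>"

text \<open>The threshold grows with the size, so this single condition with \<open>T = 2s\<close>
  controls both dangers: small combinations that vanish and larger ones that are too light.\<close>

definition contains_bad_set :: "nat \<Rightarrow> nat \<Rightarrow> nat \<Rightarrow> (nat \<Rightarrow> 'a) set \<Rightarrow> bool" where
  "contains_bad_set n k T H \<longleftrightarrow> (\<exists>s\<in>{1..T}. \<exists>S\<in>bad_sets n k s (threshold n s). S \<subseteq> H)"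

text \<open>A union bound over the sizes. Divided by the number of \<open>m\<close>-subsets it
  bounds the probability by \<open>2 * R k / sqrt l\<close>.\<close>

lemma card_contains_bad_set:
  fixes l \<epsilon> :: real
  defines "R k \<equiv> 2 * exp 2 * 3 ^ k * real k ^ k * real k ^ k / \<epsilon>\<^sup>2"
  assumes k: "k \<ge> 3" "k \<le> n" and \<epsilon>: "0 < \<epsilon>"
    and l: "0 < l" "l * units_card \<le> n" and L: "0 < ln (real units_card * real n)"
    and T: "k * T \<le> l" "16 * (R k)\<^sup>2 * T \<le> l"
    and m: "m \<le> card (sparse_vecs F n k)"
      "real m \<le> 2 * real n * (real n * real units_card / l) powr (real k / 2 - 1) / \<epsilon>\<^sup>2"
  shows "real (card {H. H \<subseteq> sparse_vecs F n k \<and> card H = m \<and> contains_bad_set n k T H}) \<le>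
    (2 * R k / sqrt l) * real (card (sparse_vecs F n k) choose m)"
proof -
  let ?V = "sparse_vecs F n k" and ?q = "real units_card"
  let ?B = "\<lambda>s. bad_sets n k s (threshold n s)"
  let ?C = "\<lambda>s. {H. H \<subseteq> ?V \<and> card H = m \<and> (\<exists>S\<in>?B s. S \<subseteq> H)}"
  have q: "?q > 0" using units_card_pos by simp
  have R0: "0 \<le> R k" using \<epsilon> by (simp add: R_def)
  have n0: "real n > 0" using k by simp
  define M0 where "M0 = (real n * ?q / k) ^ k"
  have M0: "0 < M0" "M0 \<le> card ?V"
    using q n0 k card_sparse_vecs_real_ge[OF k(2)] by (auto simp: M0_def)
  have step: "real (card (?C s)) \<le> (R k * sqrt (s / l)) ^ s * real (card ?V choose m)"
    if s: "s \<in> {1..T}" for s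
  proof -
    have s0: "real s > 0" using s by simp
    have "real k * s \<le> real k * T" using s by (intro mult_left_mono) auto
    then have ks: "real k * s \<le> l" using T by simp
    have sl: "s \<le> l"
    proof -
      have "1 * real s \<le> real k * s" using k by (intro mult_right_mono) auto
      then show ?thesis using ks by simp
    qed
    have "real k * s * ?q \<le> l * ?q" using ks q by (intro mult_right_mono) auto
    then have "real (k * s * units_card) \<le> real n" using l(2) by simp
    then have size: "k * s * units_card \<le> n" by (simp only: of_nat_le_iff)
    have D: "real (threshold n s) * ln (?q * n) \<le> s"
    proof -
      have "real (threshold n s) \<le> s / ln (?q * n)"
        using L by (simp add: threshold_def)
      then show ?thesis using L by (simp add: field_simps)
    qed
    let ?x = "?q * (3 * sqrt (real k * s * (real n * units_card))) ^ k * exp 2"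
    have x0: "0 \<le> ?x" by simp
    have bad: "real (card (?B s)) * real s ^ s \<le> ?x ^ s"
      using k s by (intro bad_sets_bound size D) auto
    have "real (card (?C s)) * real (card ?V) ^ s \<le> real (card (?B s)) * real (card ?V choose m) * real m ^ s"
      by (rule card_containing_family_bound[OF finite_sparse_vecs _ m(1)]) (auto simp: bad_sets_def)
    moreover have "real (card (?C s)) * M0 ^ s \<le> real (card (?C s)) * real (card ?V) ^ s"
      using M0 by (intro mult_left_mono power_mono) auto
    ultimately have "real (card (?C s)) * M0 ^ s * real s ^ s \<le>
        real (card (?B s)) * real (card ?V choose m) * real m ^ s * real s ^ s"
      by (intro mult_right_mono) auto
    also have "\<dots> = (real (card (?B s)) * real s ^ s) * (real (card ?V choose m) * real m ^ s)"
      by (simp only: mult_ac)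
    also have "\<dots> \<le> ?x ^ s * (real (card ?V choose m) * real m ^ s)"
      using bad by (intro mult_right_mono) auto
    finally have "real (card (?C s)) \<le> ?x ^ s * (real (card ?V choose m) * real m ^ s) / (M0 ^ s * real s ^ s)"
      using M0 s0 by (simp add: pos_le_divide_eq mult.assoc)
    \<comment> \<open>Every factor except the binomial coefficient is an \<open>s\<close>-th power,
      so it is enough to estimate the base with \<open>density_bound\<close>.\<close>
    also have "\<dots> = (?x * m / (s * M0)) ^ s * real (card ?V choose m)"
      by (simp add: power_mult_distrib power_divide mult_ac)
    also have "\<dots> \<le> (R k * sqrt (s / l)) ^ s * real (card ?V choose m)"
    proof (intro mult_right_mono power_mono)
      have "?q * m * (3 * sqrt (real k * real s * (real n * ?q))) ^ k * exp 2 / (s * (n * ?q / k) ^ k)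
          \<le> R k * sqrt (s / l)"
        unfolding R_def by (rule density_bound[OF k(1)]) (use \<epsilon> l q n0 s0 sl m in auto)
      then show "?x * m / (s * M0) \<le> R k * sqrt (s / l)" by (simp add: M0_def mult_ac)
      show "0 \<le> ?x * m / (s * M0)" using x0 s0 M0 by (intro divide_nonneg_nonneg mult_nonneg_nonneg) auto
    qed auto
    finally show ?thesis .
  qed
  have "{H. H \<subseteq> ?V \<and> card H = m \<and> contains_bad_set n k T H} = (\<Union>s\<in>{1..T}. ?C s)"
    by (auto simp: contains_bad_set_def)
  then have "card {H. H \<subseteq> ?V \<and> card H = m \<and> contains_bad_set n k T H} \<le> (\<Sum>s=1..T. card (?C s))"
    using card_UN_le[of "{1..T}" ?C] by simp
  then have "real (card {H. H \<subseteq> ?V \<and> card H = m \<and> contains_bad_set n k T H}) \<le> (\<Sum>s=1..T. real (card (?C s)))"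
    by (simp only: of_nat_sum[symmetric] of_nat_le_iff)
  also have "\<dots> \<le> (\<Sum>s=1..T. (R k * sqrt (s / l)) ^ s * real (card ?V choose m))"
    by (intro sum_mono step)
  also have "\<dots> = (\<Sum>s=1..T. (R k * sqrt (s / l)) ^ s) * real (card ?V choose m)"
    by (simp only: sum_distrib_right)
  also have "\<dots> \<le> (2 * R k / sqrt l) * real (card ?V choose m)"
    by (intro mult_right_mono sum_small_powers R0 l T) auto
  finally show ?thesis .
qed

text \<open>The equations with nonzero coefficient of a light combination would form a bad set.
  Hence a weight above the threshold, in particular above 0, holds for all sizes up to
  \<open>2s\<close>, and this yields both locale conditions. The maximum with 1 protects the degree
  against rounding to 0.\<close>

lemma pseudo_expectation_exists:
  assumes H: "H \<subseteq> sparse_vecs F n k" "\<not> contains_bad_set n k (2 * s) H"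
    and b: "\<And>v. v \<in> H \<Longrightarrow> b v \<in> carrier F" and s: "2 \<le> s"
    and L: "0 < ln (real units_card * real n)"
  shows "\<exists>E. complex_pseudo_expectation F n (max 1 (threshold n s)) E \<and> satisfies_klin F n E (H, b)"
proof -
  let ?d = "max 1 (threshold n s)"
  have finH: "finite H" using finite_subset[OF H(1)] by simp
  have Hc: "v i \<in> carrier F" if "v \<in> H" "i < n" for v i
    using H(1) that sparse_vecsD(3) by blast
  have wide: "threshold n (combination_size H \<gamma>) < card (supp F n (combination H \<gamma>))"
    if g: "\<gamma> \<in> H \<rightarrow> carrier F" and sz: "1 \<le> combination_size H \<gamma>" "combination_size H \<gamma> \<le> 2 * s" for \<gamma>
  proof (rule ccontr)
    assume neg: "\<not> ?thesis"
    let ?S = "{v\<in>H. \<gamma> v \<noteq> \<zero>}"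
    have "combination ?S \<gamma> i = combination H \<gamma> i" if "i < n" for i
      unfolding combination_def using finH g Hc that
      by (intro add.finprod_mono_neutral_cong_left) (auto simp: Pi_iff)
    then have "supp F n (combination ?S \<gamma>) = supp F n (combination H \<gamma>)"
      by (rule supp_cong)
    moreover have "\<gamma> \<in> ?S \<rightarrow> carrier F - {\<zero>}" using g by auto
    moreover have "?S \<subseteq> sparse_vecs F n k" using H(1) by auto
    ultimately have "?S \<in> bad_sets n k (combination_size H \<gamma>) (threshold n (combination_size H \<gamma>))"
      using neg unfolding bad_sets_def combination_size_def not_less
      by (intro CollectI conjI bexI[of _ \<gamma>]) simp_all
    moreover have "?S \<subseteq> H" by auto
    ultimately show False
      using H(2) sz unfolding contains_bad_set_def by (meson atLeastAtMost_iff)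
  qed
  have mono: "threshold n s \<le> threshold n t" if "s \<le> t" for t
    unfolding threshold_def using that L by (intro nat_mono floor_mono divide_right_mono) auto
  interpret expanding_klin F n s ?d H b
  proof unfold_locales
    show "finite H" by (rule finH)
    show "v i \<in> carrier F \<or> n \<le> i" if "v \<in> H" for v i using Hc[OF that] by (meson not_le)
    show "b v \<in> carrier F" if "v \<in> H" for v using b that .
    show "2 \<le> s" by (rule s)
    show "supp F n (combination H \<gamma>) \<noteq> {}"
      if "\<gamma> \<in> H \<rightarrow> carrier F" "1 \<le> combination_size H \<gamma>" "combination_size H \<gamma> \<le> 2 * s" for \<gamma>
      using wide[OF that] by auto
    show "2 * (?d div 2) < card (supp F n (combination H \<gamma>))"
      if "\<gamma> \<in> H \<rightarrow> carrier F" "s \<le> combination_size H \<gamma>" "combination_size H \<gamma> \<le> 2 * s" for \<gamma>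
    proof -
      \<comment> \<open>For \<open>?d = 1\<close> only constants are squared, so \<open>threshold n s = 0\<close> is harmless.\<close>
      have "2 * (?d div 2) \<le> threshold n s" by (cases "threshold n s \<le> 1") auto
      also have "\<dots> \<le> threshold n (combination_size H \<gamma>)" by (rule mono[OF that(2)])
      also have "\<dots> < card (supp F n (combination H \<gamma>))" using that s by (intro wide) auto
      finally show ?thesis .
    qed
  qed
  show ?thesis using pseudo_expectation pseudo_satisfies by blast
qed

end

section \<open>Value and failure probability of a random instance\<close>

lemma prob_many_matches_le:
  fixes \<epsilon> :: real
  assumes H: "finite H" "H \<noteq> {}" and A: "finite A" "A \<noteq> {}"
    and c: "\<And>v. v \<in> H \<Longrightarrow> c v \<in> A" and \<epsilon>: "0 \<le> \<epsilon>"
  shows "measure_pmf.prob (Pi_pmf H d (\<lambda>_. pmf_of_set A))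
      {b. real (card H) * (1 / card A + \<epsilon>) \<le> real (card {v\<in>H. c v = b v})}
    \<le> exp (- 2 * \<epsilon>\<^sup>2 * card H)"
proof -
  let ?P = "Pi_pmf H d (\<lambda>_. pmf_of_set A)"
  let ?X = "\<lambda>v b. indicat_real {c v} (b v)"
  have ind: "prob_space.indep_vars (measure_pmf ?P) (\<lambda>_. borel) (\<lambda>v b. indicat_real {c v} (b v)) H"
    using prob_space.indep_vars_compose2[OF measure_pmf.prob_space_axioms indep_vars_Pi_pmf[OF H(1)],
        where N = "\<lambda>_. borel" and Y = "\<lambda>v. indicat_real {c v}"] by simp
  interpret X: Hoeffding_ineq "measure_pmf ?P" H ?X "\<lambda>_. 0" "\<lambda>_. 1"
    "\<Sum>v\<in>H. measure_pmf.expectation ?P (?X v)"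
    using H ind by unfold_locales (auto simp: indicator_def)
  have mean: "measure_pmf.expectation ?P (?X v) = 1 / card A" if v: "v \<in> H" for v
  proof -
    have "measure_pmf.expectation ?P (?X v) =
        measure_pmf.expectation (map_pmf (\<lambda>b. b v) ?P) (indicat_real {c v})"
      by (rule integral_map_pmf[symmetric])
    also have "\<dots> = measure_pmf.expectation (pmf_of_set A) (indicat_real {c v})"
      using v H(1) by (simp add: Pi_pmf_component)
    also have "\<dots> = 1 / card A"
      using A c[OF v] by (simp add: measure_pmf_of_set)
    finally show ?thesis .
  qed
  have count: "(\<Sum>v\<in>H. ?X v b) = real (card {v\<in>H. c v = b v})" for b
  proof -
    have "(\<Sum>v\<in>H. ?X v b) = (\<Sum>v\<in>H. if c v = b v then 1 else 0)"
      by (intro sum.cong) (auto simp: indicator_def)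
    then show ?thesis using H(1) by (simp flip: sum.inter_filter)
  qed
  have card_pos: "real (card H) > 0" using H by (simp add: card_gt_0_iff)
  have "measure_pmf.prob ?P {b. real (card H) * (1 / card A + \<epsilon>) \<le> real (card {v\<in>H. c v = b v})}
      \<le> exp (- 2 * (real (card H) * \<epsilon>)\<^sup>2 / (\<Sum>v\<in>H. (1 - 0)\<^sup>2))"
    using X.Hoeffding_ineq_ge[of "real (card H) * \<epsilon>"] \<epsilon> card_pos
    by (simp add: mean count ring_distribs)
  also have "- 2 * (real (card H) * \<epsilon>)\<^sup>2 / (\<Sum>v\<in>H. (1 - 0)\<^sup>2) = - 2 * \<epsilon>\<^sup>2 * card H"
    using card_pos by (simp add: power2_eq_square)
  finally show ?thesis .
qed

lemma prob_bind_pmf_le: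
  assumes "\<And>x. x \<in> set_pmf p \<Longrightarrow> measure_pmf.prob (f x) X \<le> c" "0 \<le> c"
  shows "measure_pmf.prob (bind_pmf p f) X \<le> c"
proof -
  have "emeasure (measure_pmf (bind_pmf p f)) X = (\<integral>\<^sup>+x. emeasure (measure_pmf (f x)) X \<partial>measure_pmf p)"
    by simp
  also have "\<dots> \<le> (\<integral>\<^sup>+x. ennreal c \<partial>measure_pmf p)"
    using assms by (intro nn_integral_mono_AE)
      (auto simp: AE_measure_pmf_iff measure_pmf.emeasure_eq_measure intro!: ennreal_leI)
  also have "\<dots> = ennreal c" by simp
  finally show ?thesis using assms(2) by (simp add: measure_pmf.emeasure_eq_measure)
qed

context finite_field
begin

lemma klin_val_le_iff:
  "klin_val F n (H, b) \<le> t \<longleftrightarrow> (\<forall>x\<in>{..<n} \<rightarrow>\<^sub>E carrier F.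
     real (card {v\<in>H. (\<Oplus>i\<in>{..<n}. v i \<otimes> x i) = b v}) / real (card H) \<le> t)"
proof -
  have "finite ({..<n} \<rightarrow>\<^sub>E carrier F)" using finite_carrier by (intro finite_PiE) auto
  moreover have "({..<n} \<rightarrow>\<^sub>E carrier F) \<noteq> {}" by (auto simp: PiE_eq_empty_iff)
  ultimately show ?thesis unfolding klin_val_def prod.case by (subst Max_le_iff) auto
qed

lemma prob_klin_val_gt:
  fixes \<epsilon> :: real
  assumes H: "finite H" "H \<noteq> {}" "H \<subseteq> sparse_vecs F n k" and \<epsilon>: "0 < \<epsilon>"
  shows "measure_pmf.prob (Pi_pmf H \<zero> (\<lambda>_. pmf_of_set (carrier F)))
      {b. \<not> klin_val F n (H, b) \<le> 1 / card (carrier F) + \<epsilon>}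
    \<le> real (card (carrier F)) ^ n * exp (- 2 * \<epsilon>\<^sup>2 * card H)"
proof -
  let ?P = "Pi_pmf H \<zero> (\<lambda>_. pmf_of_set (carrier F))"
  let ?X = "{..<n} \<rightarrow>\<^sub>E carrier F"
  let ?c = "\<lambda>x v. (\<Oplus>i\<in>{..<n}. v i \<otimes> x i)"
  let ?B = "\<lambda>x. {b. real (card H) * (1 / card (carrier F) + \<epsilon>) \<le> real (card {v\<in>H. ?c x v = b v})}"
  have finX: "finite ?X" using finite_carrier by (intro finite_PiE) auto
  have card_pos: "real (card H) > 0" using H by (simp add: card_gt_0_iff)
  have "{b. \<not> klin_val F n (H, b) \<le> 1 / card (carrier F) + \<epsilon>} \<subseteq> (\<Union>x\<in>?X. ?B x)"
    using card_pos by (auto simp: klin_val_le_iff not_le pos_less_divide_eq mult.commute intro: less_imp_le)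
  then have "measure_pmf.prob ?P {b. \<not> klin_val F n (H, b) \<le> 1 / card (carrier F) + \<epsilon>} \<le>
      measure_pmf.prob ?P (\<Union>x\<in>?X. ?B x)"
    by (intro measure_pmf.finite_measure_mono) auto
  also have "\<dots> \<le> (\<Sum>x\<in>?X. measure_pmf.prob ?P (?B x))"
    using finX by (intro measure_UNION_le) auto
  also have "\<dots> \<le> (\<Sum>x\<in>?X. exp (- 2 * \<epsilon>\<^sup>2 * card H))"
  proof (rule sum_mono)
    fix x assume x: "x \<in> ?X"
    have "?c x v \<in> carrier F" if "v \<in> H" for v
    proof (rule finsum_closed)
      have "v i \<otimes> x i \<in> carrier F" if i: "i < n" for i
        using sparse_vecsD(3)[of v n k i] H(3) \<open>v \<in> H\<close> i PiE_mem[OF x, of i] by auto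
      then show "(\<lambda>i. v i \<otimes> x i) \<in> {..<n} \<rightarrow> carrier F" by auto
    qed
    then show "measure_pmf.prob ?P (?B x) \<le> exp (- 2 * \<epsilon>\<^sup>2 * card H)"
      using H \<epsilon> finite_carrier by (intro prob_many_matches_le) auto
  qed
  also have "\<dots> = real (card (carrier F)) ^ n * exp (- 2 * \<epsilon>\<^sup>2 * card H)"
    by (simp add: card_PiE)
  finally show ?thesis .
qed

text \<open>Separates the two sources of failure: the choice of \<open>H\<close>, measured by
  counting, and the value, bounded conditionally on each \<open>H\<close>. The property
  \<open>Q\<close> must then hold for all right-hand sides in the field once \<open>H\<close> avoids
  \<open>B\<close>.\<close>

lemma prob_random_klin_bad:
  fixes B :: "(nat \<Rightarrow> 'a) set set" and \<epsilon> \<eta> :: real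
  assumes m: "0 < m" "m \<le> card (sparse_vecs F n k)" and \<epsilon>: "0 < \<epsilon>"
  defines "\<H> \<equiv> {H. H \<subseteq> sparse_vecs F n k \<and> card H = m}"
  assumes good: "\<And>H b. H \<in> \<H> - B \<Longrightarrow> (\<And>v. v \<in> H \<Longrightarrow> b v \<in> carrier F) \<Longrightarrow> Q (H, b)"
    and B: "real (card (\<H> \<inter> B)) \<le> \<eta> * (card (sparse_vecs F n k) choose m)"
  shows "measure_pmf.prob (random_klin F n k m)
      {I. klin_val F n I \<le> 1 / card (carrier F) + \<epsilon> \<and> Q I}
    \<ge> 1 - (\<eta> + real (card (carrier F)) ^ n * exp (- 2 * \<epsilon>\<^sup>2 * m))"
proof -
  let ?P = "random_klin F n k m" and ?V = "sparse_vecs F n k"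
  let ?G = "{I. klin_val F n I \<le> 1 / card (carrier F) + \<epsilon> \<and> Q I}"
  let ?inner = "\<lambda>H. Pi_pmf H \<zero> (\<lambda>_. pmf_of_set (carrier F))"
  let ?Y = "{I. \<not> klin_val F n I \<le> 1 / card (carrier F) + \<epsilon>}"
  let ?e = "real (card (carrier F)) ^ n * exp (- 2 * \<epsilon>\<^sup>2 * m)"
  have P: "?P = bind_pmf (pmf_of_set \<H>) (\<lambda>H. map_pmf (Pair H) (?inner H))"
    by (simp add: random_klin_def \<H>_def map_pmf_def)
  have card\<H>: "card \<H> = card ?V choose m"
    unfolding \<H>_def by (rule n_subsets) simp
  have fin: "finite \<H>" unfolding \<H>_def by simp
  have pos: "card ?V choose m > 0" using m(2) by simp
  then have ne: "\<H> \<noteq> {}" using card\<H> by auto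
  have \<H>: "finite H" "H \<noteq> {}" "H \<subseteq> ?V" "card H = m" if "H \<in> \<H>" for H
    using that m(1) finite_subset[of H ?V] unfolding \<H>_def by auto
  have "measure_pmf.prob ?P {I. fst I \<in> B} = measure_pmf.prob (map_pmf fst ?P) B"
    by (simp add: vimage_def)
  also have "map_pmf fst ?P = pmf_of_set \<H>"
    unfolding P by (simp add: map_bind_pmf pmf.map_comp o_def bind_return_pmf')
  also have "measure_pmf.prob (pmf_of_set \<H>) B = real (card (\<H> \<inter> B)) / (card ?V choose m)"
    using fin ne card\<H> by (simp add: measure_pmf_of_set)
  also have "\<dots> \<le> \<eta>" using B pos by (simp add: pos_divide_le_eq)
  finally have p1: "measure_pmf.prob ?P {I. fst I \<in> B} \<le> \<eta>" .
  have p2: "measure_pmf.prob ?P ?Y \<le> ?e"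
    unfolding P
  proof (rule prob_bind_pmf_le)
    fix H assume "H \<in> set_pmf (pmf_of_set \<H>)"
    then have H: "H \<in> \<H>" using fin ne by simp
    have "measure_pmf.prob (map_pmf (Pair H) (?inner H)) ?Y =
        measure_pmf.prob (?inner H) {b. \<not> klin_val F n (H, b) \<le> 1 / card (carrier F) + \<epsilon>}"
      by (simp add: vimage_def)
    also have "\<dots> \<le> ?e"
      using prob_klin_val_gt[OF \<H>(1,2,3)[OF H] \<epsilon>] \<H>(4)[OF H] by simp
    finally show "measure_pmf.prob (map_pmf (Pair H) (?inner H)) ?Y \<le> ?e" .
  qed simp
  \<comment> \<open>Right-hand sides outside the carrier have probability 0; intersecting with the
    support removes them, so that \<open>good\<close> applies.\<close>
  have sub: "- ?G \<inter> set_pmf ?P \<subseteq> {I. fst I \<in> B} \<union> ?Y"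
  proof
    fix I assume I: "I \<in> - ?G \<inter> set_pmf ?P"
    obtain H b where Hb: "I = (H, b)" by (cases I)
    have H: "H \<in> \<H>" and b: "b \<in> set_pmf (?inner H)"
      using I fin ne unfolding P Hb by auto
    have "set_pmf (pmf_of_set (carrier F)) = carrier F"
      using finite_carrier zero_closed by (intro set_pmf_of_set) auto
    then have "b v \<in> carrier F" if "v \<in> H" for v
      using b that \<H>(1)[OF H] by (subst (asm) set_Pi_pmf) (auto simp: PiE_dflt_def)
    then show "I \<in> {I. fst I \<in> B} \<union> ?Y"
      using good[of H b] I H unfolding Hb by auto
  qed
  have "1 - measure_pmf.prob ?P ?G = measure_pmf.prob ?P (- ?G)"
    using measure_pmf.prob_compl[of ?G ?P] by (simp add: Compl_eq_Diff_UNIV)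
  also have "\<dots> = measure_pmf.prob ?P (- ?G \<inter> set_pmf ?P)"
    by (simp add: measure_Int_set_pmf)
  also have "\<dots> \<le> measure_pmf.prob ?P ({I. fst I \<in> B} \<union> ?Y)"
    using sub by (intro measure_pmf.finite_measure_mono) auto
  also have "\<dots> \<le> measure_pmf.prob ?P {I. fst I \<in> B} + measure_pmf.prob ?P ?Y"
    by (intro measure_Un_le) auto
  also have "\<dots> \<le> \<eta> + ?e" using p1 p2 by simp
  finally show ?thesis by linarith
qed

end

text \<open>The failure bound contains only \<open>n\<close>, \<open>k\<close> and
  \<open>\<epsilon>\<close>, because \<open>l \<ge> ln (qn) \<ge> ln n\<close> allows
  \<open>l\<close> to be replaced by \<open>ln n\<close>. This gives the uniformity over fields,
  \<open>l\<close> and \<open>m\<close> that the theorem asks for.\<close>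

lemma (in finite_field) prob_random_klin_good:
  fixes \<epsilon> l R K :: real and n k m :: nat
  defines "R \<equiv> 2 * exp 2 * 3 ^ k * real k ^ k * real k ^ k / \<epsilon>\<^sup>2" and "K \<equiv> 32 * R\<^sup>2 * k"
  assumes k: "3 \<le> k" and \<epsilon>: "0 < \<epsilon>" "\<epsilon> < 1"
    and n: "2 * K \<le> ln (real n)" "2 * real k ^ k / \<epsilon>\<^sup>2 \<le> n" "0 < n"
    and l: "max (real k) (ln (real units_card * real n)) \<le> l" "l \<le> real n / max (real units_card) (real k)"
    and m: "real n * (real n * real units_card / l) powr (real k / 2 - 1) / \<epsilon>\<^sup>2 \<le> m"
      "m \<le> 2 * real n * (real n * real units_card / l) powr (real k / 2 - 1) / \<epsilon>\<^sup>2"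
  shows "measure_pmf.prob (random_klin F n k m)
      {I. klin_val F n I \<le> 1 / real (card (carrier F)) + \<epsilon> \<and>
        (\<exists>d E. real d \<ge> 1 / (4 * K) * l / ln (real units_card * real n) \<and>
          complex_pseudo_expectation F n d E \<and> satisfies_klin F n E I)}
    \<ge> 1 - (2 * R / sqrt (ln (real n)) + exp (- real n))"
proof -
  let ?q = "real units_card" and ?V = "sparse_vecs F n k"
  define L where "L = ln (?q * real n)"
  define N where "N = real n * ?q"
  have q: "?q \<ge> 1" using units_card_pos by simp
  have n0: "real n > 0" using n(3) by simp
  have k0: "real k \<ge> 3" using k by simp
  have R1: "1 \<le> R"
  proof -
    have "(1::real) * 1 * 1 * 1 \<le> 2 * exp 2 * 3 ^ k * (real k ^ k * real k ^ k)"
      using k0 by (intro mult_mono one_le_power) (auto simp: mult_ge1_I one_le_power intro: order_trans[of 1 3])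
    moreover have "\<epsilon>\<^sup>2 \<le> 1" using \<epsilon> by (simp add: power_le_one)
    ultimately show ?thesis
      using \<epsilon> by (simp add: R_def le_divide_eq mult.assoc)
  qed
  have "1 \<le> R\<^sup>2" using R1 by (rule one_le_power)
  then have K: "2 * k \<le> K" "32 * R\<^sup>2 * k \<le> K" "1 \<le> K"
  proof -
    assume R2: "1 \<le> R\<^sup>2"
    have "1 * real k \<le> R\<^sup>2 * k" using R2 by (intro mult_right_mono) auto
    then show "2 * k \<le> K" "32 * R\<^sup>2 * k \<le> K" using k0 by (simp_all add: K_def)
    then show "1 \<le> K" using k0 by linarith
  qed
  have "1 * real n \<le> ?q * real n" using q by (intro mult_right_mono) auto
  then have Ln: "ln (real n) \<le> L" using n0 by (simp add: L_def)
  then have L: "2 * K \<le> L" "0 < L" "L \<le> l" using n(1) K l(1) by (auto simp: L_def)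
  have l0: "2 * K \<le> l" "0 < l" "1 \<le> l" using L K by linarith+
  have lmax: "l * max ?q k \<le> n" using l(2) q by (simp add: pos_le_divide_eq)
  have "l * ?q \<le> l * max ?q k" "l * k \<le> l * max ?q k" using l0 by (auto intro!: mult_left_mono)
  then have lq: "l * ?q \<le> n" "l * k \<le> n" using lmax by linarith+
  have "1 * real k \<le> l * k" using l0 by (intro mult_right_mono) auto
  then have kn: "k \<le> n" using lq by linarith
  \<comment> \<open>\<open>K\<close> is chosen so that \<open>T = 2 * s\<close> meets both
    \<open>k * T \<le> l\<close> and \<open>16 * R^2 * T \<le> l\<close>. Since
    \<open>2 * K \<le> ln n \<le> l\<close>, at least two equations are allowed.\<close>
  define s where "s = nat \<lfloor>l / K\<rfloor>"
  have lK: "2 \<le> l / K" using l0 K by (simp add: pos_le_divide_eq)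
  then have s: "s \<le> l / K" "l / K - 1 \<le> s" by (auto simp: s_def)
  have s2: "2 \<le> s" using lK by (simp add: s_def le_nat_iff le_floor_iff)
  have sK: "s * K \<le> l" using s K by (simp add: pos_le_divide_eq)
  have T: "k * real (2 * s) \<le> l" "16 * R\<^sup>2 * real (2 * s) \<le> l"
  proof -
    have "s * (2 * real k) \<le> s * K" using K by (intro mult_left_mono) auto
    then show "k * real (2 * s) \<le> l" using sK by (simp add: mult_ac)
    have "32 * R\<^sup>2 * 1 \<le> 32 * R\<^sup>2 * k" using k0 by (intro mult_left_mono) auto
    then have "s * (32 * R\<^sup>2) \<le> s * K" using K by (intro mult_left_mono) auto
    then show "16 * R\<^sup>2 * real (2 * s) \<le> l" using sK by (simp add: mult_ac)
  qed
  have N1: "1 \<le> N"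
  proof -
    have "1 * 1 \<le> real n * ?q" using n0 q by (intro mult_mono) auto
    then show ?thesis by (simp only: N_def mult_1)
  qed
  have nN: "real n \<le> N"
  proof -
    have "real n * 1 \<le> real n * ?q" using q by (intro mult_left_mono) auto
    then show ?thesis by (simp add: N_def)
  qed
  \<comment> \<open>From \<open>l * q \<le> n\<close> follows \<open>q^2 \<le> N / l\<close>, and
    the exponent is at least \<open>1/2\<close>. This makes \<open>m\<close> at least
    \<open>nq / \<epsilon>^2\<close>, enough for the union bound over all assignments.\<close>
  have powr_ge: "?q \<le> (N / l) powr (real k / 2 - 1)"
  proof -
    have "?q * ?q * l \<le> N" using mult_right_mono[OF lq(1), of ?q] q by (simp add: N_def mult_ac)
    then have q2: "?q\<^sup>2 \<le> N / l" using l0 by (simp add: pos_le_divide_eq power2_eq_square)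
    have "?q = (?q\<^sup>2) powr (1 / 2)" using q by (simp add: powr_half_sqrt)
    also have "\<dots> \<le> (N / l) powr (1 / 2)" using q2 by (intro powr_mono2) auto
    also have "\<dots> \<le> (N / l) powr (real k / 2 - 1)"
      using k0 q2 one_le_power[OF q, of 2] by (intro powr_mono) auto
    finally show ?thesis .
  qed
  have em: "N \<le> \<epsilon>\<^sup>2 * m"
  proof -
    have "real n * ?q \<le> real n * (N / l) powr (real k / 2 - 1)"
      using powr_ge by (intro mult_left_mono) auto
    also have "\<dots> \<le> m * \<epsilon>\<^sup>2"
      using m(1) \<epsilon> by (simp add: N_def pos_divide_le_eq)
    finally show ?thesis by (simp add: N_def mult.commute)
  qed
  have m0: "0 < m"
  proof (rule ccontr)
    assume "\<not> 0 < m"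
    then show False using em N1 by simp
  qed
  \<comment> \<open>Required for \<open>random_klin\<close> to be the intended distribution. It
    compares \<open>2 * N^(k-1) / \<epsilon>^2\<close> with \<open>(N/k)^k\<close>, hence the lower
    bound on \<open>n\<close> in terms of \<open>k^k / \<epsilon>^2\<close>.\<close>
  have mV: "m \<le> card ?V"
  proof -
    have "real m \<le> 2 * real n * (N / l) powr (real k / 2 - 1) / \<epsilon>\<^sup>2" using m(2) by (simp add: N_def)
    also have "\<dots> \<le> 2 * N * N ^ (k - 2) / \<epsilon>\<^sup>2"
    proof -
      have "(N / l) powr (real k / 2 - 1) \<le> N powr (real k / 2 - 1)"
        using l0 N1 k0 by (intro powr_mono2) (auto simp: pos_divide_le_eq mult_ge1_I mult_le_cancel_left1)
      also have "\<dots> \<le> N powr (real (k - 2))"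
        using N1 k by (intro powr_mono) (auto simp: of_nat_diff)
      also have "\<dots> = N ^ (k - 2)" using N1 by (intro powr_realpow) auto
      finally show ?thesis
        using nN N1 \<epsilon> by (intro divide_right_mono mult_mono) auto
    qed
    also have "\<dots> = (2 / \<epsilon>\<^sup>2) * N ^ (k - 1)"
    proof -
      have "k - 1 = Suc (k - 2)" using k by simp
      then show ?thesis by simp
    qed
    also have "\<dots> \<le> (N / real k ^ k) * N ^ (k - 1)"
    proof -
      have "2 * real k ^ k / \<epsilon>\<^sup>2 \<le> N" using n(2) nN by linarith
      then have "2 / \<epsilon>\<^sup>2 \<le> N / real k ^ k" using k0 \<epsilon> by (simp add: field_simps)
      then show ?thesis using N1 by (intro mult_right_mono) auto
    qed
    also have "\<dots> = (N / k) ^ k"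
    proof -
      have "N * N ^ (k - 1) = N ^ k" using k by (cases k) auto
      then show ?thesis by (simp add: power_divide)
    qed
    also have "\<dots> \<le> card ?V"
      using card_sparse_vecs_real_ge[OF kn] k by (simp add: N_def)
    finally show ?thesis by (simp only: of_nat_le_iff)
  qed
  let ?\<H> = "{H. H \<subseteq> ?V \<and> card H = m}"
  let ?B = "{H. contains_bad_set n k (2 * s) H}"
  let ?good = "\<lambda>I. \<exists>d E. real d \<ge> 1 / (4 * K) * l / L \<and>
          complex_pseudo_expectation F n d E \<and> satisfies_klin F n E I"
  have good: "?good (H, b)" if H: "H \<in> ?\<H> - ?B" and b: "\<And>v. v \<in> H \<Longrightarrow> b v \<in> carrier F" for H b
  proof -
    let ?d = "max 1 (threshold n s)"
    have "\<exists>E. complex_pseudo_expectation F n ?d E \<and> satisfies_klin F n E (H, b)"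
      using H b s2 L by (intro pseudo_expectation_exists) (auto simp: L_def)
    moreover have "1 / (4 * K) * l / L \<le> real ?d"
    proof -
      define x y where "x = s / L" and "y = l / K"
      have "threshold n s = nat \<lfloor>x\<rfloor>" by (simp add: threshold_def L_def x_def)
      then have fl: "x - 1 \<le> threshold n s" by linarith
      \<comment> \<open>One factor 2 pays for rounding \<open>x\<close> down, with the maximum with
        1 covering \<open>x \<le> 2\<close>. A second one pays for rounding \<open>l / K\<close>
        down to \<open>s\<close>. Together they give the 4 in \<open>1 / (4 * K)\<close>.\<close>
      have d: "x / 2 \<le> ?d"
      proof (cases "x \<le> 2")
        case False
        then have "x / 2 \<le> threshold n s" using fl by linarith
        then show ?thesis by linarith
      qed simp
      have "y / 2 \<le> s" using s lK unfolding y_def[symmetric] by linarith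
      then have *: "y / 2 / L \<le> x" unfolding x_def using L by (intro divide_right_mono) auto
      have "1 / (4 * K) * l / L = y / 2 / L / 2" by (simp add: y_def)
      also have "\<dots> \<le> x / 2" using * by (intro divide_right_mono) auto
      also note d
      finally show ?thesis .
    qed
    ultimately show ?thesis by blast
  qed
  have bad: "real (card (?\<H> \<inter> ?B)) \<le> (2 * R / sqrt l) * (card ?V choose m)"
  proof -
    have "?\<H> \<inter> ?B = {H. H \<subseteq> ?V \<and> card H = m \<and> contains_bad_set n k (2 * s) H}" by auto
    then show ?thesis
      using card_contains_bad_set[OF k kn \<epsilon>(1) l0(2) lq(1) L(2)[unfolded L_def] T(1)
          T(2)[unfolded R_def] mV m(2)]
      unfolding R_def by (simp only:)
  qed
  have "measure_pmf.prob (random_klin F n k m)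
      {I. klin_val F n I \<le> 1 / card (carrier F) + \<epsilon> \<and> ?good I}
    \<ge> 1 - (2 * R / sqrt l + real (card (carrier F)) ^ n * exp (- 2 * \<epsilon>\<^sup>2 * m))"
    by (rule prob_random_klin_bad[where Q = ?good, OF m0 mV \<epsilon>(1) good bad])
  moreover have "2 * R / sqrt l \<le> 2 * R / sqrt (ln (real n))"
    using Ln L R1 n(1) K by (intro divide_left_mono mult_pos_pos) auto
  \<comment> \<open>The field has \<open>q + 1 \<le> e^q\<close> elements, so there are at most
    \<open>e^N\<close> assignments, against a deviation bound of \<open>e^(-2N)\<close> for
    each.\<close>
  moreover have "real (card (carrier F)) ^ n * exp (- 2 * \<epsilon>\<^sup>2 * m) \<le> exp (- real n)"
  proof -
    have "real (card (carrier F)) ^ n \<le> exp ?q ^ n"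
    proof (rule power_mono)
      show "real (card (carrier F)) \<le> exp ?q"
        unfolding card_carrier_Suc of_nat_Suc by (rule exp_ge_add_one_self)
    qed simp
    also have "\<dots> = exp N" by (simp add: N_def exp_of_nat_mult)
    finally have "real (card (carrier F)) ^ n * exp (- 2 * \<epsilon>\<^sup>2 * m) \<le> exp N * exp (- 2 * N)"
      using em by (intro mult_mono) auto
    also have "\<dots> = exp (- N)" by (simp flip: exp_add)
    also have "\<dots> \<le> exp (- real n)" using nN by simp
    finally show ?thesis .
  qed
  ultimately show ?thesis unfolding L_def[symmetric] by linarith
qed

theorem theorem7p14:
  fixes k :: nat
  assumes "k \<ge> 3"
  shows "\<exists>(C1::real) (C2::real) (a::nat). 0 < C1 \<and> C1 < C2 \<and>
    (\<forall>\<epsilon>::real. 0 < \<epsilon> \<longrightarrow> \<epsilon> < 1 \<longrightarrow>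
      (\<exists>c::real. 0 < c \<and>
        (\<forall>\<delta>::real. 0 < \<delta> \<longrightarrow>
          (\<exists>N::nat. \<forall>n\<ge>N. \<forall>(F :: 'a ring) (q::nat) (l::real) (m::nat).
             field F \<longrightarrow> finite (carrier F) \<longrightarrow>
             q = card (carrier F - {\<zero>\<^bsub>F\<^esub>}) \<longrightarrow>
             max (real k) (ln (real q * real n)) \<le> l \<longrightarrow>
             l \<le> real n / max (real q) (real k) \<longrightarrow>
             C1 * real n * (real n * real q / l) powr (real k / 2 - 1) / \<epsilon>\<^sup>2 \<le> real m \<longrightarrow>
             real m \<le> C2 * real n * (real n * real q / l) powr (real k / 2 - 1) / \<epsilon>\<^sup>2 \<longrightarrow>
             measure_pmf.prob (random_klin F n k m)
               {I. klin_val F n I \<le> 1 / real (card (carrier F)) + \<epsilon> \<and>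
                   (\<exists>d E. real d \<ge> c * l / ln (real q * real n) ^ a \<and>
                          complex_pseudo_expectation F n d E \<and>
                          satisfies_klin F n E I)}
               \<ge> 1 - \<delta>))))"
proof (rule exI[of _ 1], rule exI[of _ 2], rule exI[of _ 1], intro conjI allI impI)
  \<comment> \<open>The witnesses are \<open>C1 = 1\<close>, \<open>C2 = 2\<close> and
    \<open>a = 1\<close>, a single logarithm.\<close>
  fix \<epsilon> :: real
  assume \<epsilon>: "0 < \<epsilon>" "\<epsilon> < 1"
  define R where "R = 2 * exp 2 * 3 ^ k * real k ^ k * real k ^ k / \<epsilon>\<^sup>2"
  define K where "K = 32 * R\<^sup>2 * k"
  have R: "R > 0" using \<epsilon> assms by (simp add: R_def)
  then have K: "K > 0" using assms by (simp add: K_def)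
  show "\<exists>c::real. 0 < c \<and> (\<forall>\<delta>::real. 0 < \<delta> \<longrightarrow>
          (\<exists>N::nat. \<forall>n\<ge>N. \<forall>(F :: 'a ring) (q::nat) (l::real) (m::nat).
             field F \<longrightarrow> finite (carrier F) \<longrightarrow>
             q = card (carrier F - {\<zero>\<^bsub>F\<^esub>}) \<longrightarrow>
             max (real k) (ln (real q * real n)) \<le> l \<longrightarrow>
             l \<le> real n / max (real q) (real k) \<longrightarrow>
             1 * real n * (real n * real q / l) powr (real k / 2 - 1) / \<epsilon>\<^sup>2 \<le> real m \<longrightarrow>
             real m \<le> 2 * real n * (real n * real q / l) powr (real k / 2 - 1) / \<epsilon>\<^sup>2 \<longrightarrow>
             measure_pmf.prob (random_klin F n k m)
               {I. klin_val F n I \<le> 1 / real (card (carrier F)) + \<epsilon> \<and>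
                   (\<exists>d E. real d \<ge> c * l / ln (real q * real n) ^ 1 \<and>
                          complex_pseudo_expectation F n d E \<and>
                          satisfies_klin F n E I)}
               \<ge> 1 - \<delta>))"
  \<comment> \<open>This constant depends on \<open>k\<close> and \<open>\<epsilon>\<close> only, as
    it is chosen before \<open>\<delta>\<close>, \<open>n\<close> and the field.\<close>
  proof (rule exI[of _ "1 / (4 * K)"], intro conjI allI impI)
    show "0 < 1 / (4 * K)" using K by simp
    fix \<delta> :: real assume \<delta>: "0 < \<delta>"
    have ln_top: "filterlim (\<lambda>n::nat. ln (real n)) at_top sequentially"
      by (rule filterlim_compose[OF ln_at_top filterlim_real_sequentially])
    have "(\<lambda>n::nat. 2 * R / sqrt (ln (real n)) + exp (- real n)) \<longlonglongrightarrow> 0 + 0"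
    proof (rule tendsto_add)
      show "(\<lambda>n::nat. 2 * R / sqrt (ln (real n))) \<longlonglongrightarrow> 0"
        by (rule real_tendsto_divide_at_top[OF tendsto_const filterlim_compose[OF sqrt_at_top ln_top]])
      show "(\<lambda>n::nat. exp (- real n)) \<longlonglongrightarrow> 0"
        by (rule filterlim_compose[OF exp_at_bot filterlim_compose[OF filterlim_uminus_at_bot_at_top filterlim_real_sequentially]])
    qed
    then have "eventually (\<lambda>n. 2 * R / sqrt (ln (real n)) + exp (- real n) < \<delta>) sequentially"
      using \<delta> by (intro order_tendstoD(2)) auto
    moreover have "eventually (\<lambda>n. 2 * K \<le> ln (real n)) sequentially"
      using ln_top by (simp add: filterlim_at_top)
    moreover have "eventually (\<lambda>n. 2 * real k ^ k / \<epsilon>\<^sup>2 \<le> real n) sequentially"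
      using filterlim_real_sequentially by (simp add: filterlim_at_top)
    moreover have "eventually (\<lambda>n::nat. 0 < n) sequentially" by (rule eventually_gt_at_top)
    ultimately have "eventually (\<lambda>n. 2 * R / sqrt (ln (real n)) + exp (- real n) < \<delta> \<and>
        2 * K \<le> ln (real n) \<and> 2 * real k ^ k / \<epsilon>\<^sup>2 \<le> real n \<and> 0 < n) sequentially"
      by (intro eventually_conj)
    then obtain N where N: "\<And>n. n \<ge> N \<Longrightarrow> 2 * R / sqrt (ln (real n)) + exp (- real n) < \<delta> \<and>
        2 * K \<le> ln (real n) \<and> 2 * real k ^ k / \<epsilon>\<^sup>2 \<le> real n \<and> 0 < n"
      unfolding eventually_sequentially by blast
    show "\<exists>N::nat. \<forall>n\<ge>N. \<forall>(F :: 'a ring) (q::nat) (l::real) (m::nat).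
             field F \<longrightarrow> finite (carrier F) \<longrightarrow>
             q = card (carrier F - {\<zero>\<^bsub>F\<^esub>}) \<longrightarrow>
             max (real k) (ln (real q * real n)) \<le> l \<longrightarrow>
             l \<le> real n / max (real q) (real k) \<longrightarrow>
             1 * real n * (real n * real q / l) powr (real k / 2 - 1) / \<epsilon>\<^sup>2 \<le> real m \<longrightarrow>
             real m \<le> 2 * real n * (real n * real q / l) powr (real k / 2 - 1) / \<epsilon>\<^sup>2 \<longrightarrow>
             measure_pmf.prob (random_klin F n k m)
               {I. klin_val F n I \<le> 1 / real (card (carrier F)) + \<epsilon> \<and>
                   (\<exists>d E. real d \<ge> 1 / (4 * K) * l / ln (real q * real n) ^ 1 \<and>
                          complex_pseudo_expectation F n d E \<and>
                          satisfies_klin F n E I)}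
               \<ge> 1 - \<delta>"
    proof (rule exI[of _ N], intro allI impI)
      fix n m q :: nat and F :: "'a ring" and l :: real
      assume n: "N \<le> n" and F: "field F" "finite (carrier F)"
        and q: "q = card (carrier F - {\<zero>\<^bsub>F\<^esub>})"
        and l: "max (real k) (ln (real q * real n)) \<le> l" "l \<le> real n / max (real q) (real k)"
        and m: "1 * real n * (real n * real q / l) powr (real k / 2 - 1) / \<epsilon>\<^sup>2 \<le> real m"
          "real m \<le> 2 * real n * (real n * real q / l) powr (real k / 2 - 1) / \<epsilon>\<^sup>2"
      have N': "2 * K \<le> ln (real n)" "2 * real k ^ k / \<epsilon>\<^sup>2 \<le> real n" "0 < n"
        and small: "2 * R / sqrt (ln (real n)) + exp (- real n) < \<delta>"
        using N[OF n] by blast+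
      note m' = m(1)[unfolded mult_1] m(2)
      interpret finite_field F
        using F by (intro finite_field.intro finite_field_axioms.intro)
      have "measure_pmf.prob (random_klin F n k m)
          {I. klin_val F n I \<le> 1 / real (card (carrier F)) + \<epsilon> \<and>
            (\<exists>d E. real d \<ge> 1 / (4 * K) * l / ln (real q * real n) \<and>
              complex_pseudo_expectation F n d E \<and> satisfies_klin F n E I)}
        \<ge> 1 - (2 * R / sqrt (ln (real n)) + exp (- real n))"
        unfolding R_def K_def q
        by (rule prob_random_klin_good[OF assms \<epsilon> N'[unfolded K_def R_def] l[unfolded q] m'(1)[unfolded q] m'(2)[unfolded q]])
      then show "measure_pmf.prob (random_klin F n k m)
               {I. klin_val F n I \<le> 1 / real (card (carrier F)) + \<epsilon> \<and>
                   (\<exists>d E. real d \<ge> 1 / (4 * K) * l / ln (real q * real n) ^ 1 \<and>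
                          complex_pseudo_expectation F n d E \<and>
                          satisfies_klin F n E I)}
               \<ge> 1 - \<delta>"
        unfolding power_one_right using small by linarith
    qed
  qed
qed simp_all

end
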